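(* Let $\mathcal{T}$ be a triangulated category with suspension functor $\Sigma$ and let $\mathcal{A}$ be an abelian subcategory of $\mathcal{T}$ satisfying $\mathcal{T}(\mathcal{A},\Sigma^{-1}\mathcal{A})=0$. Consider a diagram $a\xrightarrow{f}b\xrightarrow{g}c$ in $\mathcal{A}$. The following statements are equivalent: (1) The sequence $0\to a\xrightarrow{f}b\xrightarrow{g}c\to0$ is short exact in $\mathcal{A}$. (2) There exist distinguished triangles $a\xrightarrow{f}b\xrightarrow{g'}z\to\Sigma a$ and $\Sigma^{-1}c\to x\xrightarrow{f'}b\xrightarrow{g}c$ in $\mathcal{T}$ and morphisms $\varepsilon\colon a\to x$ and $\eta\colon z\to c$ in $\mathcal{T}$ such that $f'\varepsilon=f$ and $\eta g'=g$, the morphism $\varepsilon\colon a\to x$ is a strong $\mathcal{A}$-cover, and the morphism $\eta\colon z\to c$ is a strong $\mathcal{A}$-envelope.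
   Context: Conventions: subcategories are full and closed under isomorphisms; an abelian subcategory of $\mathcal{T}$ is an additive subcategory (full, with additive inclusion) which is an abelian category. The condition $\mathcal{T}(\mathcal{A},\Sigma^{-1}\mathcal{A})=0$ means $\mathrm{Hom}_{\mathcal{T}}(a,\Sigma^{-1}a')=0$ for all $a,a'$ in $\mathcal{A}$. Let $\mathcal{Y}$ be an additive subcategory of an additive category $\mathcal{X}$ and $X$ an object of $\mathcal{X}$. A strong $\mathcal{Y}$-cover of $X$ is a morphism $c\colon Y\to X$ with $Y$ in $\mathcal{Y}$ such that for every $Y'$ in $\mathcal{Y}$ the map $\mathcal{X}(Y',c)\colon\mathcal{X}(Y',Y)\to\mathcal{X}(Y',X)$ is an isomorphism. Dually, a strong $\mathcal{Y}$-envelope of $X$ is a morphism $e\colon X\to Y$ with $Y$ in $\mathcal{Y}$ such that $\mathcal{X}(e,Y')\colon\mathcal{X}(Y,Y')\to\mathcal{X}(X,Y')$ is an isomorphism for every $Y'$ in $\mathcal{Y}$. *)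

theory Defs
  imports "HOL-Algebra.Group"
begin

text \<open>
  Categories are records with a set of objects and a set of morphisms, every morphism having a
  domain and a codomain. Composition is written in the usual order: \<open>g \<cdot> f\<close> is
  \<open>f\<close> followed by \<open>g\<close>; its value on non-composable pairs is unspecified.
\<close>

record ('o, 'm) category =
  Obj :: "'o set"
  Mor :: "'m set"
  Dom :: "'m \<Rightarrow> 'o"
  Cod :: "'m \<Rightarrow> 'o"
  ident :: "'o \<Rightarrow> 'm"
  cmp :: "'m \<Rightarrow> 'm \<Rightarrow> 'm"  (infixr "\<cdot>\<index>" 70)

definition Hom :: "('o, 'm, 'e) category_scheme \<Rightarrow> 'o \<Rightarrow> 'o \<Rightarrow> 'm set" where
  "Hom C x y = {f \<in> Mor C. Dom C f = x \<and> Cod C f = y}"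

locale category =
  fixes C :: "('o, 'm, 'e) category_scheme" (structure)
  assumes Dom_closed: "f \<in> Mor C \<Longrightarrow> Dom C f \<in> Obj C"
    and Cod_closed: "f \<in> Mor C \<Longrightarrow> Cod C f \<in> Obj C"
    and ident_closed: "x \<in> Obj C \<Longrightarrow> ident C x \<in> Hom C x x"
    and cmp_closed: "f \<in> Hom C x y \<Longrightarrow> g \<in> Hom C y z \<Longrightarrow> g \<cdot> f \<in> Hom C x z"
    and cmp_ident: "f \<in> Hom C x y \<Longrightarrow> f \<cdot> ident C x = f"
    and ident_cmp: "f \<in> Hom C x y \<Longrightarrow> ident C y \<cdot> f = f"
    and cmp_assoc: "f \<in> Hom C w x \<Longrightarrow> g \<in> Hom C x y \<Longrightarrow> h \<in> Hom C y z \<Longrightarrow>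
      (h \<cdot> g) \<cdot> f = h \<cdot> (g \<cdot> f)"

definition isomorphism :: "('o, 'm, 'e) category_scheme \<Rightarrow> 'm \<Rightarrow> bool" where
  "isomorphism C f \<longleftrightarrow> f \<in> Mor C \<and>
    (\<exists>g \<in> Hom C (Cod C f) (Dom C f).
       g \<cdot>\<^bsub>C\<^esub> f = ident C (Dom C f) \<and> f \<cdot>\<^bsub>C\<^esub> g = ident C (Cod C f))"

definition monic :: "('o, 'm, 'e) category_scheme \<Rightarrow> 'm \<Rightarrow> bool" where
  "monic C f \<longleftrightarrow> f \<in> Mor C \<and>
    (\<forall>x \<in> Obj C. \<forall>g \<in> Hom C x (Dom C f). \<forall>h \<in> Hom C x (Dom C f).
       f \<cdot>\<^bsub>C\<^esub> g = f \<cdot>\<^bsub>C\<^esub> h \<longrightarrow> g = h)"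

definition epic :: "('o, 'm, 'e) category_scheme \<Rightarrow> 'm \<Rightarrow> bool" where
  "epic C f \<longleftrightarrow> f \<in> Mor C \<and>
    (\<forall>x \<in> Obj C. \<forall>g \<in> Hom C (Cod C f) x. \<forall>h \<in> Hom C (Cod C f) x.
       g \<cdot>\<^bsub>C\<^esub> f = h \<cdot>\<^bsub>C\<^esub> f \<longrightarrow> g = h)"

definition zero_object :: "('o, 'm, 'e) category_scheme \<Rightarrow> 'o \<Rightarrow> bool" where
  "zero_object C z \<longleftrightarrow> z \<in> Obj C \<and>
    (\<forall>x \<in> Obj C. (\<exists>!f. f \<in> Hom C x z) \<and> (\<exists>!f. f \<in> Hom C z x))"

definition full_sub ::
    "('o, 'm, 'e) category_scheme \<Rightarrow> 'o set \<Rightarrow> ('o, 'm, 'e) category_scheme" where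
  "full_sub C A = C\<lparr>Obj := A, Mor := {f \<in> Mor C. Dom C f \<in> A \<and> Cod C f \<in> A}\<rparr>"


record ('o, 'm, 'p, 'n) ftor =
  fob :: "'o \<Rightarrow> 'p"
  fmor :: "'m \<Rightarrow> 'n"

definition is_functor ::
    "('o, 'm, 'e) category_scheme \<Rightarrow> ('p, 'n, 'd) category_scheme \<Rightarrow> ('o, 'm, 'p, 'n) ftor \<Rightarrow> bool" where
  "is_functor C D F \<longleftrightarrow>
    (\<forall>x \<in> Obj C. fob F x \<in> Obj D) \<and>
    (\<forall>x \<in> Obj C. \<forall>y \<in> Obj C. \<forall>f \<in> Hom C x y. fmor F f \<in> Hom D (fob F x) (fob F y)) \<and>
    (\<forall>x \<in> Obj C. fmor F (ident C x) = ident D (fob F x)) \<and>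
    (\<forall>x \<in> Obj C. \<forall>y \<in> Obj C. \<forall>z \<in> Obj C. \<forall>f \<in> Hom C x y. \<forall>g \<in> Hom C y z.
       fmor F (g \<cdot>\<^bsub>C\<^esub> f) = fmor F g \<cdot>\<^bsub>D\<^esub> fmor F f)"

definition id_ftor :: "('o, 'm, 'o, 'm) ftor" where
  "id_ftor = \<lparr>fob = \<lambda>x. x, fmor = \<lambda>f. f\<rparr>"

definition comp_ftor ::
    "('p, 'n, 'q, 'l) ftor \<Rightarrow> ('o, 'm, 'p, 'n) ftor \<Rightarrow> ('o, 'm, 'q, 'l) ftor" where
  "comp_ftor G F = \<lparr>fob = \<lambda>x. fob G (fob F x), fmor = \<lambda>f. fmor G (fmor F f)\<rparr>"

definition natural_iso ::
    "('o, 'm, 'e) category_scheme \<Rightarrow> ('p, 'n, 'd) category_scheme \<Rightarrow>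
     ('o, 'm, 'p, 'n) ftor \<Rightarrow> ('o, 'm, 'p, 'n) ftor \<Rightarrow> ('o \<Rightarrow> 'n) \<Rightarrow> bool" where
  "natural_iso C D F G t \<longleftrightarrow>
    (\<forall>x \<in> Obj C. t x \<in> Hom D (fob F x) (fob G x) \<and> isomorphism D (t x)) \<and>
    (\<forall>x \<in> Obj C. \<forall>y \<in> Obj C. \<forall>f \<in> Hom C x y. t y \<cdot>\<^bsub>D\<^esub> fmor F f = fmor G f \<cdot>\<^bsub>D\<^esub> t x)"


record ('o, 'm) preadd = "('o, 'm) category" +
  hadd :: "'m \<Rightarrow> 'm \<Rightarrow> 'm"
  hzero :: "'o \<Rightarrow> 'o \<Rightarrow> 'm"

definition homgrp :: "('o, 'm, 'e) preadd_scheme \<Rightarrow> 'o \<Rightarrow> 'o \<Rightarrow> 'm monoid" where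
  "homgrp C x y = \<lparr>carrier = Hom C x y, mult = hadd C, one = hzero C x y\<rparr>"

locale preadditive_category = category C
  for C :: "('o, 'm, 'e) preadd_scheme" (structure) +
  assumes hom_comm_group: "x \<in> Obj C \<Longrightarrow> y \<in> Obj C \<Longrightarrow> comm_group (homgrp C x y)"
    and cmp_hadd: "f \<in> Hom C x y \<Longrightarrow> g \<in> Hom C y z \<Longrightarrow> g' \<in> Hom C y z \<Longrightarrow>
      hadd C g g' \<cdot> f = hadd C (g \<cdot> f) (g' \<cdot> f)"
    and hadd_cmp: "f \<in> Hom C x y \<Longrightarrow> f' \<in> Hom C x y \<Longrightarrow> g \<in> Hom C y z \<Longrightarrow>
      g \<cdot> hadd C f f' = hadd C (g \<cdot> f) (g \<cdot> f')"

locale additive_category = preadditive_category C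
  for C :: "('o, 'm, 'e) preadd_scheme" (structure) +
  assumes ex_zero_object: "\<exists>z. zero_object C z"
    and ex_biproduct: "x \<in> Obj C \<Longrightarrow> y \<in> Obj C \<Longrightarrow>
      \<exists>s \<in> Obj C. \<exists>i \<in> Hom C x s. \<exists>j \<in> Hom C y s. \<exists>p \<in> Hom C s x. \<exists>q \<in> Hom C s y.
        p \<cdot> i = ident C x \<and> q \<cdot> j = ident C y \<and>
        q \<cdot> i = hzero C x y \<and> p \<cdot> j = hzero C y x \<and>
        hadd C (i \<cdot> p) (j \<cdot> q) = ident C s"

definition is_additive_functor ::
    "('o, 'm, 'e) preadd_scheme \<Rightarrow> ('p, 'n, 'd) preadd_scheme \<Rightarrow> ('o, 'm, 'p, 'n) ftor \<Rightarrow> bool" where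
  "is_additive_functor C D F \<longleftrightarrow> is_functor C D F \<and>
    (\<forall>x \<in> Obj C. \<forall>y \<in> Obj C. fmor F \<in> hom (homgrp C x y) (homgrp D (fob F x) (fob F y)))"

definition is_kernel :: "('o, 'm, 'e) preadd_scheme \<Rightarrow> 'm \<Rightarrow> 'm \<Rightarrow> bool" where
  "is_kernel C k f \<longleftrightarrow> f \<in> Mor C \<and> k \<in> Mor C \<and> Cod C k = Dom C f \<and>
    f \<cdot>\<^bsub>C\<^esub> k = hzero C (Dom C k) (Cod C f) \<and>
    (\<forall>x \<in> Obj C. \<forall>h \<in> Hom C x (Dom C f). f \<cdot>\<^bsub>C\<^esub> h = hzero C x (Cod C f) \<longrightarrow>
       (\<exists>!l. l \<in> Hom C x (Dom C k) \<and> k \<cdot>\<^bsub>C\<^esub> l = h))"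

definition is_cokernel :: "('o, 'm, 'e) preadd_scheme \<Rightarrow> 'm \<Rightarrow> 'm \<Rightarrow> bool" where
  "is_cokernel C p f \<longleftrightarrow> f \<in> Mor C \<and> p \<in> Mor C \<and> Dom C p = Cod C f \<and>
    p \<cdot>\<^bsub>C\<^esub> f = hzero C (Dom C f) (Cod C p) \<and>
    (\<forall>x \<in> Obj C. \<forall>h \<in> Hom C (Cod C f) x. h \<cdot>\<^bsub>C\<^esub> f = hzero C (Dom C f) x \<longrightarrow>
       (\<exists>!l. l \<in> Hom C (Cod C p) x \<and> l \<cdot>\<^bsub>C\<^esub> p = h))"

locale abelian_category = additive_category C
  for C :: "('o, 'm, 'e) preadd_scheme" (structure) +
  assumes ex_kernel: "f \<in> Mor C \<Longrightarrow> \<exists>k. is_kernel C k f"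
    and ex_cokernel: "f \<in> Mor C \<Longrightarrow> \<exists>p. is_cokernel C p f"
    and monic_normal: "monic C f \<Longrightarrow> \<exists>g. is_kernel C f g"
    and epic_normal: "epic C f \<Longrightarrow> \<exists>g. is_cokernel C f g"

definition is_image :: "('o, 'm, 'e) preadd_scheme \<Rightarrow> 'm \<Rightarrow> 'm \<Rightarrow> bool" where
  "is_image C m f \<longleftrightarrow> (\<exists>p. is_cokernel C p f \<and> is_kernel C m p)"

text \<open>
  Exactness of \<open>f\<close> followed by \<open>g\<close> at the middle object: the image of
  \<open>f\<close> and the kernel of \<open>g\<close> are the same subobject. As both are determined only
  up to isomorphism over the middle object, this says that some morphism represents both.
\<close>

definition exact_at :: "('o, 'm, 'e) preadd_scheme \<Rightarrow> 'm \<Rightarrow> 'm \<Rightarrow> bool" where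
  "exact_at C f g \<longleftrightarrow> (\<exists>m. is_image C m f \<and> is_kernel C m g)"

definition short_exact :: "('o, 'm, 'e) preadd_scheme \<Rightarrow> 'm \<Rightarrow> 'm \<Rightarrow> bool" where
  "short_exact C f g \<longleftrightarrow>
    (\<exists>z. zero_object C z \<and>
       exact_at C (hzero C z (Dom C f)) f \<and> exact_at C f g \<and> exact_at C g (hzero C (Cod C g) z))"


text \<open>
  The suspension \<open>susp\<close> is an additive autoequivalence, with a chosen quasi-inverse
  \<open>desusp\<close> (written \<open>\<Sigma>\<^sup>-\<^sup>1\<close> in the literature) and chosen
  natural isomorphisms \<open>unit\<^sub>1\<close> from the identity to
  \<open>\<Sigma>\<^sup>-\<^sup>1\<Sigma>\<close> and \<open>unit\<^sub>2\<close> from the identity to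
  \<open>\<Sigma>\<Sigma>\<^sup>-\<^sup>1\<close>. If the suspension is an automorphism, these can be
  taken to be identities.
\<close>

record ('o, 'm) triang = "('o, 'm) preadd" +
  susp :: "('o, 'm, 'o, 'm) ftor"
  desusp :: "('o, 'm, 'o, 'm) ftor"
  unit\<^sub>1 :: "'o \<Rightarrow> 'm"
  unit\<^sub>2 :: "'o \<Rightarrow> 'm"
  Tri :: "('m \<times> 'm \<times> 'm) set"

definition dist_triangle ::
    "('o, 'm, 'e) triang_scheme \<Rightarrow> 'o \<Rightarrow> 'o \<Rightarrow> 'o \<Rightarrow> 'm \<Rightarrow> 'm \<Rightarrow> 'm \<Rightarrow> bool" where
  "dist_triangle T x y z f g h \<longleftrightarrow>
    x \<in> Obj T \<and> y \<in> Obj T \<and> z \<in> Obj T \<and>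
    f \<in> Hom T x y \<and> g \<in> Hom T y z \<and> h \<in> Hom T z (fob (susp T) x) \<and> (f, g, h) \<in> Tri T"

text \<open>
  A distinguished triangle written in the form
  \<open>\<Sigma>\<^sup>-\<^sup>1z \<rightarrow> x \<rightarrow> y \<rightarrow> z\<close>: the last object is identified with
  \<open>\<Sigma>\<Sigma>\<^sup>-\<^sup>1z\<close> by means of the chosen natural isomorphism.
\<close>

definition dist_triangle_desusp ::
    "('o, 'm, 'e) triang_scheme \<Rightarrow> 'o \<Rightarrow> 'o \<Rightarrow> 'o \<Rightarrow> 'm \<Rightarrow> 'm \<Rightarrow> 'm \<Rightarrow> bool" where
  "dist_triangle_desusp T x y z u f g \<longleftrightarrow>
    z \<in> Obj T \<and> g \<in> Hom T y z \<and>
    dist_triangle T (fob (desusp T) z) x y u f (unit\<^sub>2 T z \<cdot>\<^bsub>T\<^esub> g)"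

text \<open>The axiom TR1 consists of \<open>tri_iso\<close>, \<open>tri_ident\<close> and \<open>tri_ex\<close>; TR2 is
  \<open>tri_rotate\<close>, where the inverse is the negative in the Hom group; TR3 is
  \<open>tri_morphism\<close>.\<close>

locale triangulated_category = additive_category T
  for T :: "('o, 'm, 'e) triang_scheme" (structure) +
  assumes susp_additive: "is_additive_functor T T (susp T)"
    and desusp_additive: "is_additive_functor T T (desusp T)"
    and unit\<^sub>1_iso: "natural_iso T T id_ftor (comp_ftor (desusp T) (susp T)) (unit\<^sub>1 T)"
    and unit\<^sub>2_iso: "natural_iso T T id_ftor (comp_ftor (susp T) (desusp T)) (unit\<^sub>2 T)"
    and tri_wf: "(f, g, h) \<in> Tri T \<Longrightarrow> \<exists>x y z. dist_triangle T x y z f g h"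
    and tri_iso: "dist_triangle T x y z f g h \<Longrightarrow>
      f' \<in> Hom T x' y' \<Longrightarrow> g' \<in> Hom T y' z' \<Longrightarrow> h' \<in> Hom T z' (fob (susp T) x') \<Longrightarrow>
      p \<in> Hom T x x' \<Longrightarrow> q \<in> Hom T y y' \<Longrightarrow> r \<in> Hom T z z' \<Longrightarrow>
      isomorphism T p \<Longrightarrow> isomorphism T q \<Longrightarrow> isomorphism T r \<Longrightarrow>
      q \<cdot> f = f' \<cdot> p \<Longrightarrow> r \<cdot> g = g' \<cdot> q \<Longrightarrow> fmor (susp T) p \<cdot> h = h' \<cdot> r \<Longrightarrow>
      dist_triangle T x' y' z' f' g' h'"
    and tri_ident: "x \<in> Obj T \<Longrightarrow> zero_object T z \<Longrightarrow>
      dist_triangle T x x z (ident T x) (hzero T x z) (hzero T z (fob (susp T) x))"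
    and tri_ex: "x \<in> Obj T \<Longrightarrow> y \<in> Obj T \<Longrightarrow> f \<in> Hom T x y \<Longrightarrow>
      \<exists>z g h. dist_triangle T x y z f g h"
    and tri_rotate: "x \<in> Obj T \<Longrightarrow> y \<in> Obj T \<Longrightarrow> z \<in> Obj T \<Longrightarrow>
      f \<in> Hom T x y \<Longrightarrow> g \<in> Hom T y z \<Longrightarrow> h \<in> Hom T z (fob (susp T) x) \<Longrightarrow>
      dist_triangle T x y z f g h \<longleftrightarrow>
      dist_triangle T y z (fob (susp T) x) g h
        (inv\<^bsub>homgrp T (fob (susp T) x) (fob (susp T) y)\<^esub> (fmor (susp T) f))"
    and tri_morphism: "dist_triangle T x y z f g h \<Longrightarrow> dist_triangle T x' y' z' f' g' h' \<Longrightarrow>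
      p \<in> Hom T x x' \<Longrightarrow> q \<in> Hom T y y' \<Longrightarrow> q \<cdot> f = f' \<cdot> p \<Longrightarrow>
      \<exists>r \<in> Hom T z z'. r \<cdot> g = g' \<cdot> q \<and> fmor (susp T) p \<cdot> h = h' \<cdot> r"
    and octahedral: "dist_triangle T x y u f f\<^sub>1 f\<^sub>2 \<Longrightarrow> dist_triangle T y z w g g\<^sub>1 g\<^sub>2 \<Longrightarrow>
      dist_triangle T x z v (g \<cdot> f) h\<^sub>1 h\<^sub>2 \<Longrightarrow>
      \<exists>p \<in> Hom T u v. \<exists>q \<in> Hom T v w.
        dist_triangle T u v w p q (fmor (susp T) f\<^sub>1 \<cdot> g\<^sub>2) \<and>
        p \<cdot> f\<^sub>1 = h\<^sub>1 \<cdot> g \<and> h\<^sub>2 \<cdot> p = f\<^sub>2 \<and> q \<cdot> h\<^sub>1 = g\<^sub>1 \<and> g\<^sub>2 \<cdot> q = fmor (susp T) f \<cdot> h\<^sub>2"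


text \<open>Subcategories are full and closed under isomorphisms, so they are given by sets of objects.
  The inclusion is additive because the subcategory inherits the addition of morphisms.\<close>

definition additive_subcategory :: "('o, 'm, 'e) preadd_scheme \<Rightarrow> 'o set \<Rightarrow> bool" where
  "additive_subcategory X Y \<longleftrightarrow> Y \<subseteq> Obj X \<and>
    (\<forall>f \<in> Mor X. isomorphism X f \<and> Dom X f \<in> Y \<longrightarrow> Cod X f \<in> Y) \<and>
    additive_category (full_sub X Y)"

definition abelian_subcategory :: "('o, 'm, 'e) preadd_scheme \<Rightarrow> 'o set \<Rightarrow> bool" where
  "abelian_subcategory X Y \<longleftrightarrow> additive_subcategory X Y \<and> abelian_category (full_sub X Y)"

definition strong_cover ::
    "('o, 'm, 'e) preadd_scheme \<Rightarrow> 'o set \<Rightarrow> 'o \<Rightarrow> 'o \<Rightarrow> 'm \<Rightarrow> bool" where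
  "strong_cover X Y y x c \<longleftrightarrow> y \<in> Y \<and> c \<in> Hom X y x \<and>
    (\<forall>y' \<in> Y. (\<lambda>h. c \<cdot>\<^bsub>X\<^esub> h) \<in> iso (homgrp X y' y) (homgrp X y' x))"

definition strong_envelope ::
    "('o, 'm, 'e) preadd_scheme \<Rightarrow> 'o set \<Rightarrow> 'o \<Rightarrow> 'o \<Rightarrow> 'm \<Rightarrow> bool" where
  "strong_envelope X Y x y e \<longleftrightarrow> y \<in> Y \<and> e \<in> Hom X x y \<and>
    (\<forall>y' \<in> Y. (\<lambda>h. h \<cdot>\<^bsub>X\<^esub> e) \<in> iso (homgrp X y y') (homgrp X x y'))"

end

theory Submission
  imports Defs "HOL-Algebra.Coset"
begin

text \<open>
  In an abelian category, short exactness means that \<open>f\<close> is a kernel of \<open>g\<close> and \<open>g\<close> is a cokernel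
  of \<open>f\<close>. In the triangle \<open>a \<rightarrow> b \<rightarrow> z \<rightarrow> \<Sigma>a\<close> the morphism \<open>b \<rightarrow> z\<close> is a weak cokernel of
  \<open>f\<close>, and since morphisms \<open>\<Sigma>a \<rightarrow> y\<close> vanish for \<open>y\<close> in \<open>A\<close>, morphisms \<open>z \<rightarrow> y\<close> correspond to
  the morphisms \<open>b \<rightarrow> y\<close> annihilating \<open>f\<close>. Hence \<open>\<eta> : z \<rightarrow> c\<close> is a strong envelope exactly if
  \<open>g\<close> is a cokernel of \<open>f\<close> in \<open>A\<close>. Dually for \<open>\<epsilon>\<close>, strong covers and kernels.
\<close>

section \<open>Preadditive categories\<close>

lemma HomD:
  assumes "f \<in> Hom C x y"
  shows "f \<in> Mor C" "Dom C f = x" "Cod C f = y"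
  using assms by (auto simp: Hom_def)

lemma homgrp_simps [simp]:
  "carrier (homgrp C x y) = Hom C x y"
  "mult (homgrp C x y) = hadd C"
  "one (homgrp C x y) = hzero C x y"
  by (auto simp: homgrp_def)

section \<open>Isomorphisms and natural isomorphisms out of the identity functor\<close>

context category
begin

lemma Hom_Obj:
  assumes "f \<in> Hom C x y"
  shows "x \<in> Obj C" "y \<in> Obj C"
  using assms Dom_closed Cod_closed by (auto simp: Hom_def)

lemma isomorphism_inverse:
  assumes "isomorphism C t" "t \<in> Hom C x y"
  obtains s where "s \<in> Hom C y x" "s \<cdot> t = ident C x" "t \<cdot> s = ident C y"
  using assms unfolding isomorphism_def Hom_def by blast

lemma isomorphismI:
  assumes "t \<in> Hom C x y" "s \<in> Hom C y x" "s \<cdot> t = ident C x" "t \<cdot> s = ident C y"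
  shows "isomorphism C t"
  using assms unfolding isomorphism_def Hom_def by auto

lemma isomorphism_ident:
  assumes "x \<in> Obj C"
  shows "isomorphism C (ident C x)"
  using ident_closed[OF assms] cmp_ident isomorphismI by blast

lemma isomorphism_cancel:
  assumes "isomorphism C t" "t \<in> Hom C y z" "f \<in> Hom C x y" "g \<in> Hom C x y" "t \<cdot> f = t \<cdot> g"
  shows "f = g"
proof -
  obtain s where s: "s \<in> Hom C z y" "s \<cdot> t = ident C y"
    using isomorphism_inverse assms(1,2) by metis
  show ?thesis
    using cmp_assoc[OF assms(3) assms(2) s(1)] cmp_assoc[OF assms(4) assms(2) s(1)]
      ident_cmp[OF assms(3)] ident_cmp[OF assms(4)] assms(5) s(2) by simp
qed

lemma natural_iso_id_Hom:
  assumes "natural_iso C C id_ftor F t" "x \<in> Obj C"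
  shows "t x \<in> Hom C x (fob F x)" "isomorphism C (t x)"
  using assms unfolding natural_iso_def id_ftor_def by auto

lemma natural_iso_id_naturality:
  assumes "natural_iso C C id_ftor F t" "f \<in> Hom C x y"
  shows "t y \<cdot> f = fmor F f \<cdot> t x"
  using assms Hom_Obj[OF assms(2)] unfolding natural_iso_def id_ftor_def by auto

text \<open>Naturality turns \<open>fmor F f = fmor F g\<close> into
  \<open>t y \<cdot> f = t y \<cdot> g\<close>, and the isomorphism \<open>t y\<close> cancels. With
  \<open>F\<close> a composite of the suspension and its quasi-inverse, this makes the inner functor
  faithful.\<close>

lemma natural_iso_id_faithful:
  assumes "natural_iso C C id_ftor F t" "f \<in> Hom C x y" "g \<in> Hom C x y" "fmor F f = fmor F g"
  shows "f = g"
  using isomorphism_cancel[OF natural_iso_id_Hom(2,1)[OF assms(1) Hom_Obj(2)[OF assms(2)]] assms(2,3)]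
    natural_iso_id_naturality[OF assms(1)] assms by metis

end

section \<open>Hom groups, bilinearity of composition and cancellation\<close>

context preadditive_category
begin

abbreviation hneg :: "'o \<Rightarrow> 'o \<Rightarrow> 'm \<Rightarrow> 'm" where
  "hneg x y f \<equiv> inv\<^bsub>homgrp C x y\<^esub> f"

lemma hom_group: "x \<in> Obj C \<Longrightarrow> y \<in> Obj C \<Longrightarrow> group (homgrp C x y)"
  using hom_comm_group comm_group.axioms(2) by blast

lemma hzero_closed [intro]: "x \<in> Obj C \<Longrightarrow> y \<in> Obj C \<Longrightarrow> hzero C x y \<in> Hom C x y"
  using monoid.one_closed[OF group.is_monoid[OF hom_group], of x y] by simp

lemma hneg_closed: "f \<in> Hom C x y \<Longrightarrow> hneg x y f \<in> Hom C x y"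
  using group.inv_closed[OF hom_group, of x y f] Hom_Obj[of f x y] by simp

lemma hneg_hneg: "f \<in> Hom C x y \<Longrightarrow> hneg x y (hneg x y f) = f"
  using group.inv_inv[OF hom_group, of x y f] Hom_Obj[of f x y] by simp

lemma precomp_hom:
  assumes "f \<in> Hom C x y" "z \<in> Obj C"
  shows "(\<lambda>g. g \<cdot> f) \<in> hom (homgrp C y z) (homgrp C x z)"
  using assms cmp_hadd cmp_closed by (auto simp: hom_def)

lemma postcomp_hom:
  assumes "g \<in> Hom C y z" "x \<in> Obj C"
  shows "(\<lambda>f. g \<cdot> f) \<in> hom (homgrp C x y) (homgrp C x z)"
  using assms hadd_cmp cmp_closed by (auto simp: hom_def)

lemma precomp_group_hom:
  assumes "f \<in> Hom C x y" "z \<in> Obj C"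
  shows "group_hom (homgrp C y z) (homgrp C x z) (\<lambda>g. g \<cdot> f)"
  using precomp_hom[OF assms] hom_group Hom_Obj[OF assms(1)] assms(2)
  by (simp add: group_hom_def group_hom_axioms_def)

lemma postcomp_group_hom:
  assumes "g \<in> Hom C y z" "x \<in> Obj C"
  shows "group_hom (homgrp C x y) (homgrp C x z) (\<lambda>f. g \<cdot> f)"
  using postcomp_hom[OF assms] hom_group Hom_Obj[OF assms(1)] assms(2)
  by (simp add: group_hom_def group_hom_axioms_def)

lemma hzero_cmp: "f \<in> Hom C x y \<Longrightarrow> z \<in> Obj C \<Longrightarrow> hzero C y z \<cdot> f = hzero C x z"
  using group_hom.hom_one[OF precomp_group_hom, of f x y z] by simp

lemma cmp_hzero: "g \<in> Hom C y z \<Longrightarrow> x \<in> Obj C \<Longrightarrow> g \<cdot> hzero C x y = hzero C x z"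
  using group_hom.hom_one[OF postcomp_group_hom, of g y z x] by simp

lemma hneg_cmp: "f \<in> Hom C x y \<Longrightarrow> g \<in> Hom C y z \<Longrightarrow> hneg y z g \<cdot> f = hneg x z (g \<cdot> f)"
  using group_hom.hom_inv[OF precomp_group_hom, of f x y z g] Hom_Obj[of g y z] by simp

lemma cmp_hneg: "f \<in> Hom C x y \<Longrightarrow> g \<in> Hom C y z \<Longrightarrow> g \<cdot> hneg x y f = hneg x z (g \<cdot> f)"
  using group_hom.hom_inv[OF postcomp_group_hom, of g y z x f] Hom_Obj[of f x y] by simp

lemma hneg_eq_iff:
  assumes "f \<in> Hom C x y" "g \<in> Hom C x y"
  shows "hneg x y f = hneg x y g \<longleftrightarrow> f = g"
  using hneg_hneg assms by metis

text \<open>Composition with \<open>g\<close> on the left is a homomorphism of Hom groups, so a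
  trivial kernel makes it injective. Uniqueness claims thereby reduce to a test against
  zero.\<close>

lemma postcomp_cancel:
  assumes "g \<in> Hom C y z" "\<phi> \<in> Hom C x y" "\<psi> \<in> Hom C x y" "g \<cdot> \<phi> = g \<cdot> \<psi>"
    and "\<And>k. k \<in> Hom C x y \<Longrightarrow> g \<cdot> k = hzero C x z \<Longrightarrow> k = hzero C x y"
  shows "\<phi> = \<psi>"
proof -
  have o: "x \<in> Obj C" using Hom_Obj assms by blast
  interpret h: group_hom "homgrp C x y" "homgrp C x z" "\<lambda>f. g \<cdot> f"
    using postcomp_group_hom[OF assms(1) o] .
  have "inj_on (\<lambda>f. g \<cdot> f) (Hom C x y)"
    using h.inj_on_one_iff assms(5) by simp
  then show ?thesis using assms by (auto dest: inj_onD)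
qed

lemma precomp_cancel:
  assumes "f \<in> Hom C x y" "\<phi> \<in> Hom C y z" "\<psi> \<in> Hom C y z" "\<phi> \<cdot> f = \<psi> \<cdot> f"
    and "\<And>k. k \<in> Hom C y z \<Longrightarrow> k \<cdot> f = hzero C x z \<Longrightarrow> k = hzero C y z"
  shows "\<phi> = \<psi>"
proof -
  have o: "z \<in> Obj C" using Hom_Obj assms by blast
  interpret h: group_hom "homgrp C y z" "homgrp C x z" "\<lambda>g. g \<cdot> f"
    using precomp_group_hom[OF assms(1) o] .
  have "inj_on (\<lambda>g. g \<cdot> f) (Hom C y z)"
    using h.inj_on_one_iff assms(5) by simp
  then show ?thesis using assms by (auto dest: inj_onD)
qed

section \<open>Zero objects\<close>

lemma zero_object_ident:
  assumes "zero_object C z"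
  shows "ident C z = hzero C z z"
  using assms ident_closed hzero_closed unfolding zero_object_def by blast

lemma zero_object_Hom:
  assumes "zero_object C z" "x \<in> Obj C"
  shows "Hom C x z = {hzero C x z}" "Hom C z x = {hzero C z x}"
  using assms hzero_closed unfolding zero_object_def by blast+

text \<open>A morphism into or out of \<open>z\<close> equals its composite with the identity of
  \<open>z\<close>; once that identity is zero, so is the morphism.\<close>

lemma zero_objectI:
  assumes "z \<in> Obj C" "ident C z = hzero C z z"
  shows "zero_object C z"
proof -
  have "f = hzero C x z" if "f \<in> Hom C x z" for f x
    using ident_cmp[OF that] hzero_cmp[OF that assms(1)] assms(2) by simp
  moreover have "f = hzero C z x" if "f \<in> Hom C z x" for f x
    using cmp_ident[OF that] cmp_hzero[OF that assms(1)] assms(2) by simp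
  ultimately show ?thesis
    using assms(1) hzero_closed unfolding zero_object_def by blast
qed

section \<open>Kernels and cokernels, with uniqueness expressed as vanishing\<close>

lemma is_kernelI:
  assumes "f \<in> Hom C x y" "g \<in> Hom C y z" "g \<cdot> f = hzero C x z"
    and "\<And>w \<phi>. \<phi> \<in> Hom C w y \<Longrightarrow> g \<cdot> \<phi> = hzero C w z \<Longrightarrow> \<exists>\<psi> \<in> Hom C w x. f \<cdot> \<psi> = \<phi>"
    and "\<And>w \<psi>. \<psi> \<in> Hom C w x \<Longrightarrow> f \<cdot> \<psi> = hzero C w y \<Longrightarrow> \<psi> = hzero C w x"
  shows "is_kernel C f g"
proof -
  \<comment> \<open>Two lifts of the same morphism agree by cancellation, which yields the unique
    lift that \<open>is_kernel\<close> asks for.\<close>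
  have "\<psi> = \<psi>'" if "\<psi> \<in> Hom C w x" "\<psi>' \<in> Hom C w x" "f \<cdot> \<psi> = f \<cdot> \<psi>'" for w \<psi> \<psi>'
    using postcomp_cancel[OF assms(1) that] assms(5) by blast
  then show ?thesis
    using HomD[OF assms(1)] HomD[OF assms(2)] assms(3,4) unfolding is_kernel_def by metis
qed

lemma is_cokernelI:
  assumes "f \<in> Hom C x y" "g \<in> Hom C y z" "g \<cdot> f = hzero C x z"
    and "\<And>w \<phi>. \<phi> \<in> Hom C y w \<Longrightarrow> \<phi> \<cdot> f = hzero C x w \<Longrightarrow> \<exists>\<psi> \<in> Hom C z w. \<psi> \<cdot> g = \<phi>"
    and "\<And>w \<psi>. \<psi> \<in> Hom C z w \<Longrightarrow> \<psi> \<cdot> g = hzero C y w \<Longrightarrow> \<psi> = hzero C z w"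
  shows "is_cokernel C g f"
proof -
  have "\<psi> = \<psi>'" if "\<psi> \<in> Hom C z w" "\<psi>' \<in> Hom C z w" "\<psi> \<cdot> g = \<psi>' \<cdot> g" for w \<psi> \<psi>'
    using precomp_cancel[OF assms(2) that] assms(5) by blast
  then show ?thesis
    using HomD[OF assms(1)] HomD[OF assms(2)] assms(3,4) unfolding is_cokernel_def by metis
qed

text \<open>Returns a kernel in the form that \<open>is_kernelI\<close> accepts. The object
  \<open>x\<close> is obtained rather than given because it is read off from \<open>k\<close> as its
  domain.\<close>

lemma is_kernelE:
  assumes "is_kernel C k g" "g \<in> Hom C y z"
  obtains x where "k \<in> Hom C x y" "g \<cdot> k = hzero C x z"
    "\<And>w \<phi>. \<phi> \<in> Hom C w y \<Longrightarrow> g \<cdot> \<phi> = hzero C w z \<Longrightarrow> \<exists>\<psi> \<in> Hom C w x. k \<cdot> \<psi> = \<phi>"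
    "\<And>w \<psi>. \<psi> \<in> Hom C w x \<Longrightarrow> k \<cdot> \<psi> = hzero C w y \<Longrightarrow> \<psi> = hzero C w x"
proof
  have d: "Dom C g = y" "Cod C g = z" using HomD[OF assms(2)] by auto
  note k = assms(1)[unfolded is_kernel_def d]
  show kH: "k \<in> Hom C (Dom C k) y" and 0: "g \<cdot> k = hzero C (Dom C k) z"
    using k by (auto simp: Hom_def)
  fix w
  have ex: "\<exists>!\<psi>. \<psi> \<in> Hom C w (Dom C k) \<and> k \<cdot> \<psi> = \<phi>"
    if "\<phi> \<in> Hom C w y" "g \<cdot> \<phi> = hzero C w z" for \<phi>
    using k that Hom_Obj[OF that(1)] by blast
  show "\<exists>\<psi> \<in> Hom C w (Dom C k). k \<cdot> \<psi> = \<phi>"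
    if "\<phi> \<in> Hom C w y" "g \<cdot> \<phi> = hzero C w z" for \<phi>
    using ex[OF that] by blast
  show "\<psi> = hzero C w (Dom C k)"
    if "\<psi> \<in> Hom C w (Dom C k)" "k \<cdot> \<psi> = hzero C w y" for \<psi>
  proof -
    have w: "w \<in> Obj C" using Hom_Obj that by blast
    \<comment> \<open>Both \<psi> and a zero morphism lift \<open>hzero C w y\<close> through
      \<open>k\<close>, so unique lifting identifies them.\<close>
    have "hzero C w y \<in> Hom C w y" "g \<cdot> hzero C w y = hzero C w z"
      using w Hom_Obj[OF assms(2)] hzero_closed cmp_hzero[OF assms(2)] by auto
    from ex[OF this] show ?thesis
      using that cmp_hzero[OF kH w] hzero_closed[OF w] Hom_Obj[OF kH] by blast
  qed
qed

lemma is_cokernelE: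
  assumes "is_cokernel C p f" "f \<in> Hom C x y"
  obtains z where "p \<in> Hom C y z" "p \<cdot> f = hzero C x z"
    "\<And>w \<phi>. \<phi> \<in> Hom C y w \<Longrightarrow> \<phi> \<cdot> f = hzero C x w \<Longrightarrow> \<exists>\<psi> \<in> Hom C z w. \<psi> \<cdot> p = \<phi>"
    "\<And>w \<psi>. \<psi> \<in> Hom C z w \<Longrightarrow> \<psi> \<cdot> p = hzero C y w \<Longrightarrow> \<psi> = hzero C z w"
proof
  have d: "Dom C f = x" "Cod C f = y" using HomD[OF assms(2)] by auto
  note p = assms(1)[unfolded is_cokernel_def d]
  show pH: "p \<in> Hom C y (Cod C p)" and 0: "p \<cdot> f = hzero C x (Cod C p)"
    using p by (auto simp: Hom_def)
  fix w
  have ex: "\<exists>!\<psi>. \<psi> \<in> Hom C (Cod C p) w \<and> \<psi> \<cdot> p = \<phi>"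
    if "\<phi> \<in> Hom C y w" "\<phi> \<cdot> f = hzero C x w" for \<phi>
    using p that Hom_Obj[OF that(1)] by blast
  show "\<exists>\<psi> \<in> Hom C (Cod C p) w. \<psi> \<cdot> p = \<phi>"
    if "\<phi> \<in> Hom C y w" "\<phi> \<cdot> f = hzero C x w" for \<phi>
    using ex[OF that] by blast
  show "\<psi> = hzero C (Cod C p) w"
    if "\<psi> \<in> Hom C (Cod C p) w" "\<psi> \<cdot> p = hzero C y w" for \<psi>
  proof -
    have w: "w \<in> Obj C" using Hom_Obj that by blast
    have "hzero C y w \<in> Hom C y w" "hzero C y w \<cdot> f = hzero C x w"
      using w Hom_Obj[OF assms(2)] hzero_closed hzero_cmp[OF assms(2)] by auto
    from ex[OF this] show ?thesis
      using that hzero_cmp[OF pH w] hzero_closed[OF _ w] Hom_Obj[OF pH] by blast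
  qed
qed

lemma monicI:
  assumes "f \<in> Hom C x y"
    and "\<And>w \<psi>. \<psi> \<in> Hom C w x \<Longrightarrow> f \<cdot> \<psi> = hzero C w y \<Longrightarrow> \<psi> = hzero C w x"
  shows "monic C f"
  using HomD[OF assms(1)] postcomp_cancel[OF assms(1)] assms(2) unfolding monic_def by metis

lemma epicI:
  assumes "g \<in> Hom C y z"
    and "\<And>w \<psi>. \<psi> \<in> Hom C z w \<Longrightarrow> \<psi> \<cdot> g = hzero C y w \<Longrightarrow> \<psi> = hzero C z w"
  shows "epic C g"
  using HomD[OF assms(1)] precomp_cancel[OF assms(1)] assms(2) unfolding epic_def by metis

end

section \<open>Short exact sequences in abelian categories\<close>

context abelian_category
begin

text \<open>The cokernel \<open>p\<close> of the zero morphism into \<open>a\<close> has a left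
  inverse, so its kernel \<open>m\<close> is zero. By exactness \<open>m\<close> is also a kernel of
  \<open>f\<close>, hence anything killed by \<open>f\<close> factors through zero.\<close>

lemma exact_at_zero_left:
  assumes "zero_object C z" "f \<in> Hom C a b" "exact_at C (hzero C z a) f"
    and "\<psi> \<in> Hom C w a" "f \<cdot> \<psi> = hzero C w b"
  shows "\<psi> = hzero C w a"
proof -
  have o: "z \<in> Obj C" "a \<in> Obj C" "b \<in> Obj C" "w \<in> Obj C"
    using assms(1) Hom_Obj[OF assms(2)] Hom_Obj[OF assms(4)] by (auto simp: zero_object_def)
  obtain m p where p: "is_cokernel C p (hzero C z a)" and m: "is_kernel C m p" "is_kernel C m f"
    using assms(3) unfolding exact_at_def is_image_def by blast
  obtain q where q: "p \<in> Hom C a q"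
    "\<And>w \<phi>. \<phi> \<in> Hom C a w \<Longrightarrow> \<phi> \<cdot> hzero C z a = hzero C z w \<Longrightarrow> \<exists>\<psi> \<in> Hom C q w. \<psi> \<cdot> p = \<phi>"
    using is_cokernelE[OF p hzero_closed[OF o(1,2)]] by metis
  \<comment> \<open>The identity of \<open>a\<close> annihilates the zero morphism from
    \<open>z\<close> and therefore factors through its cokernel.\<close>
  obtain l where l: "l \<in> Hom C q a" "l \<cdot> p = ident C a"
    using q(2)[OF ident_closed[OF o(2)]] cmp_hzero[OF ident_closed[OF o(2)] o(1)] by blast
  obtain k where k: "m \<in> Hom C k a" "p \<cdot> m = hzero C k q"
    using is_kernelE[OF m(1) q(1)] by metis
  have k': "k \<in> Obj C" using Hom_Obj k by blast
  have "m = ident C a \<cdot> m" using ident_cmp[OF k(1)] by simp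
  also have "\<dots> = l \<cdot> (p \<cdot> m)" using cmp_assoc[OF k(1) q(1) l(1)] l(2) by simp
  also have "\<dots> = hzero C k a" using k(2) cmp_hzero[OF l(1) k'] by simp
  finally have m0: "m = hzero C k a" .
  obtain k2 where "m \<in> Hom C k2 a" "\<exists>\<chi> \<in> Hom C w k2. m \<cdot> \<chi> = \<psi>"
    using is_kernelE[OF m(2) assms(2)] assms(4,5) by metis
  then obtain \<chi> where "\<chi> \<in> Hom C w k" "m \<cdot> \<chi> = \<psi>"
    using HomD k(1) by metis
  then show ?thesis using m0 hzero_cmp o(2) by metis
qed

text \<open>The kernel \<open>m\<close> of the zero morphism out of \<open>c\<close> has a right
  inverse, and the cokernel \<open>p\<close> of \<open>g\<close> kills \<open>m\<close>, so
  \<open>p\<close> is zero. Anything that kills \<open>g\<close> factors through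
  \<open>p\<close>.\<close>

lemma exact_at_zero_right:
  assumes "zero_object C z" "g \<in> Hom C b c" "exact_at C g (hzero C c z)"
    and "\<psi> \<in> Hom C c w" "\<psi> \<cdot> g = hzero C b w"
  shows "\<psi> = hzero C c w"
proof -
  have o: "z \<in> Obj C" "b \<in> Obj C" "c \<in> Obj C" "w \<in> Obj C"
    using assms(1) Hom_Obj[OF assms(2)] Hom_Obj[OF assms(4)] by (auto simp: zero_object_def)
  obtain m p where p: "is_cokernel C p g" and m: "is_kernel C m p" "is_kernel C m (hzero C c z)"
    using assms(3) unfolding exact_at_def is_image_def by blast
  obtain k where k: "m \<in> Hom C k c"
    "\<And>w \<phi>. \<phi> \<in> Hom C w c \<Longrightarrow> hzero C c z \<cdot> \<phi> = hzero C w z \<Longrightarrow> \<exists>\<psi> \<in> Hom C w k. m \<cdot> \<psi> = \<phi>"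
    using is_kernelE[OF m(2) hzero_closed[OF o(3,1)]] by metis
  obtain l where l: "l \<in> Hom C c k" "m \<cdot> l = ident C c"
    using k(2)[OF ident_closed[OF o(3)]] hzero_cmp[OF ident_closed[OF o(3)] o(1)] by blast
  obtain q where q: "p \<in> Hom C c q" "\<exists>\<chi> \<in> Hom C q w. \<chi> \<cdot> p = \<psi>"
    using is_cokernelE[OF p assms(2)] assms(4,5) by metis
  have q': "q \<in> Obj C" using Hom_Obj q by blast
  have pm: "p \<cdot> m = hzero C k q"
    using is_kernelE[OF m(1) q(1)] HomD k(1) by metis
  have "p = p \<cdot> ident C c" using cmp_ident[OF q(1)] by simp
  also have "\<dots> = (p \<cdot> m) \<cdot> l" using cmp_assoc[OF l(1) k(1) q(1)] l(2) by simp
  also have "\<dots> = hzero C c q" using pm hzero_cmp[OF l(1) q'] by simp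
  finally have "p = hzero C c q" .
  then show ?thesis using q(2) cmp_hzero o(3) by metis
qed

text \<open>Exactness at the ends makes \<open>f\<close> monic and \<open>g\<close> epic, hence by
  normality a kernel of some \<open>r\<close> and a cokernel of some \<open>r'\<close>. The common
  representative \<open>m\<close> of the image of \<open>f\<close> and the kernel of
  \<open>g\<close> then transfers these universal properties to the pair \<open>f\<close>,
  \<open>g\<close>.\<close>

lemma short_exact_imp:
  assumes "f \<in> Hom C a b" "g \<in> Hom C b c" "short_exact C f g"
  shows "is_kernel C f g" "is_cokernel C g f"
proof -
  have d: "Dom C f = a" "Cod C g = c" using HomD assms by metis+
  obtain z where z: "zero_object C z" "exact_at C (hzero C z a) f" "exact_at C f g"
      "exact_at C g (hzero C c z)"
    using assms(3) unfolding short_exact_def d by blast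
  note mono = exact_at_zero_left[OF z(1) assms(1) z(2)]
  note epi = exact_at_zero_right[OF z(1) assms(2) z(4)]
  obtain m p where p: "is_cokernel C p f" and m: "is_kernel C m p" "is_kernel C m g"
    using z(3) unfolding exact_at_def is_image_def by blast
  obtain q where q: "p \<in> Hom C b q" "p \<cdot> f = hzero C a q"
    "\<And>w \<phi>. \<phi> \<in> Hom C b w \<Longrightarrow> \<phi> \<cdot> f = hzero C a w \<Longrightarrow> \<exists>\<psi> \<in> Hom C q w. \<psi> \<cdot> p = \<phi>"
    using is_cokernelE[OF p assms(1)] by metis
  obtain k where k: "m \<in> Hom C k b" "p \<cdot> m = hzero C k q"
    "\<And>w \<phi>. \<phi> \<in> Hom C w b \<Longrightarrow> p \<cdot> \<phi> = hzero C w q \<Longrightarrow> \<exists>\<psi> \<in> Hom C w k. m \<cdot> \<psi> = \<phi>"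
    using is_kernelE[OF m(1) q(1)] by metis
  obtain k2 where k2: "m \<in> Hom C k2 b" "g \<cdot> m = hzero C k2 c"
    "\<And>w \<phi>. \<phi> \<in> Hom C w b \<Longrightarrow> g \<cdot> \<phi> = hzero C w c \<Longrightarrow> \<exists>\<psi> \<in> Hom C w k2. m \<cdot> \<psi> = \<phi>"
    using is_kernelE[OF m(2) assms(2)] by metis
  \<comment> \<open>Both objects are the domain of \<open>m\<close>.\<close>
  have k2k: "k2 = k" using HomD k(1) k2(1) by metis
  have o: "a \<in> Obj C" "b \<in> Obj C" "c \<in> Obj C" "k \<in> Obj C" "q \<in> Obj C"
    using Hom_Obj[OF assms(1)] Hom_Obj[OF assms(2)] Hom_Obj[OF k(1)] Hom_Obj[OF q(1)] by auto
  \<comment> \<open>The cokernel \<open>p\<close> kills \<open>f\<close>, so \<open>f\<close>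
    factors through its kernel \<open>m\<close>, which \<open>g\<close> kills.\<close>
  have gf: "g \<cdot> f = hzero C a c"
  proof -
    obtain l where l: "l \<in> Hom C a k" "m \<cdot> l = f" using k(3)[OF assms(1) q(2)] by blast
    then show ?thesis
      using cmp_assoc[OF l(1) k(1) assms(2)] k2(2) hzero_cmp[OF l(1) o(3)] k2k by simp
  qed
  obtain r e where r: "is_kernel C f r" "r \<in> Hom C b e"
  proof -
    obtain r where r: "is_kernel C f r" using monic_normal[OF monicI[OF assms(1) mono]] by blast
    then have "r \<in> Hom C b (Cod C r)"
      using HomD[OF assms(1)] by (auto simp: is_kernel_def Hom_def)
    then show ?thesis using r that by blast
  qed
  show "is_kernel C f g"
  proof (rule is_kernelI[OF assms(1,2) gf _ mono])
    fix w \<phi> assume \<phi>: "\<phi> \<in> Hom C w b" "g \<cdot> \<phi> = hzero C w c"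
    obtain \<psi> where \<psi>: "\<psi> \<in> Hom C w k" "m \<cdot> \<psi> = \<phi>" using k2(3)[OF \<phi>] k2k by blast
    have w: "w \<in> Obj C" using Hom_Obj \<phi> by blast
    have p\<phi>: "p \<cdot> \<phi> = hzero C w q"
      using cmp_assoc[OF \<psi>(1) k(1) q(1)] \<psi>(2) k(2) hzero_cmp[OF \<psi>(1) o(5)] by simp
    obtain a' where a': "f \<in> Hom C a' b" "r \<cdot> f = hzero C a' e"
      "r \<cdot> \<phi> = hzero C w e \<Longrightarrow> \<exists>\<psi> \<in> Hom C w a'. f \<cdot> \<psi> = \<phi>"
      using is_kernelE[OF r] \<phi>(1) by metis
    have aa: "a' = a" using a'(1) assms(1) HomD by metis
    \<comment> \<open>Since \<open>r\<close> kills \<open>f\<close>, it factors through the cokernel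
      \<open>p\<close>. As \<open>p\<close> kills \<phi>, so does \<open>r\<close>, and \<phi> lifts
      along \<open>f\<close>, a kernel of \<open>r\<close>.\<close>
    obtain s where s: "s \<in> Hom C q e" "s \<cdot> p = r" using q(3)[OF r(2)] a'(2) aa by blast
    have "r \<cdot> \<phi> = hzero C w e"
      using cmp_assoc[OF \<phi>(1) q(1) s(1)] s(2) p\<phi> cmp_hzero[OF s(1) w] by simp
    then show "\<exists>\<psi> \<in> Hom C w a. f \<cdot> \<psi> = \<phi>" using a'(3) aa by blast
  qed auto
  obtain r' e' where r': "is_cokernel C g r'" "r' \<in> Hom C e' b"
  proof -
    obtain r where r: "is_cokernel C g r" using epic_normal[OF epicI[OF assms(2) epi]] by blast
    then have "r \<in> Hom C (Dom C r) b"
      using HomD[OF assms(2)] by (auto simp: is_cokernel_def Hom_def)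
    then show ?thesis using r that by blast
  qed
  show "is_cokernel C g f"
  proof (rule is_cokernelI[OF assms(1,2) gf _ epi])
    fix w \<phi> assume \<phi>: "\<phi> \<in> Hom C b w" "\<phi> \<cdot> f = hzero C a w"
    obtain \<psi> where \<psi>: "\<psi> \<in> Hom C q w" "\<psi> \<cdot> p = \<phi>" using q(3)[OF \<phi>] by blast
    have w: "w \<in> Obj C" using Hom_Obj \<phi> by blast
    have \<phi>m: "\<phi> \<cdot> m = hzero C k w"
      using cmp_assoc[OF k(1) q(1) \<psi>(1)] \<psi>(2) k(2) cmp_hzero[OF \<psi>(1) o(4)] by simp
    obtain c' where c': "g \<in> Hom C b c'" "g \<cdot> r' = hzero C e' c'"
      "\<phi> \<cdot> r' = hzero C e' w \<Longrightarrow> \<exists>\<psi> \<in> Hom C c' w. \<psi> \<cdot> g = \<phi>"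
      using is_cokernelE[OF r'] \<phi>(1) by metis
    have cc: "c' = c" using c'(1) assms(2) HomD by metis
    \<comment> \<open>Since \<open>g\<close> kills \<open>r'\<close>, it factors through
      \<open>m\<close>, which \<phi> kills. Hence \<phi> kills \<open>r'\<close> and descends along
      \<open>g\<close>, a cokernel of \<open>r'\<close>.\<close>
    obtain s where s: "s \<in> Hom C e' k" "m \<cdot> s = r'" using k2(3)[OF r'(2)] c'(2) cc k2k by blast
    have "\<phi> \<cdot> r' = hzero C e' w"
      using cmp_assoc[OF s(1) k(1) \<phi>(1)] s(2) \<phi>m hzero_cmp[OF s(1) w] by simp
    then show "\<exists>\<psi> \<in> Hom C c w. \<psi> \<cdot> g = \<phi>" using c'(3) cc by blast
  qed auto
qed

text \<open>The common image and kernel is exhibited at each place: the zero morphism from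
  \<open>z\<close> at \<open>a\<close>, the morphism \<open>f\<close> at \<open>b\<close>, and the
  identity at \<open>c\<close>. The cokernels defining the images are the identity of
  \<open>a\<close>, the morphism \<open>g\<close>, and the zero morphism from \<open>c\<close> to
  \<open>z\<close>.\<close>

lemma short_exactI:
  assumes "f \<in> Hom C a b" "g \<in> Hom C b c" "is_kernel C f g" "is_cokernel C g f"
  shows "short_exact C f g"
proof -
  obtain z where z: "zero_object C z" using ex_zero_object by blast
  have o: "a \<in> Obj C" "b \<in> Obj C" "c \<in> Obj C" "z \<in> Obj C"
    using Hom_Obj[OF assms(1)] Hom_Obj[OF assms(2)] z by (auto simp: zero_object_def)
  have d: "Dom C f = a" "Cod C g = c" using HomD assms by metis+
  note fz = zero_object_Hom(1)[OF z] and tz = zero_object_Hom(2)[OF z]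
  have mono: "\<psi> = hzero C w a" if "\<psi> \<in> Hom C w a" "f \<cdot> \<psi> = hzero C w b" for w \<psi>
    using is_kernelE[OF assms(3,2)] that HomD[OF assms(1)] HomD by metis
  have epi: "\<psi> = hzero C c w" if "\<psi> \<in> Hom C c w" "\<psi> \<cdot> g = hzero C b w" for w \<psi>
    using is_cokernelE[OF assms(4,1)] that HomD[OF assms(2)] HomD by metis
  have za: "hzero C z a \<in> Hom C z a" and cz: "hzero C c z \<in> Hom C c z"
    using hzero_closed o by auto
  have ida: "ident C a \<in> Hom C a a" and idc: "ident C c \<in> Hom C c c"
    using ident_closed o by auto
  have to_z: "\<psi> = hzero C w z" if "\<psi> \<in> Hom C w z" for w \<psi>
    using fz Hom_Obj[OF that] that by blast
  have from_z: "\<psi> = hzero C z w" if "\<psi> \<in> Hom C z w" for w \<psi>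
    using tz Hom_Obj[OF that] that by blast
  have lift: "\<exists>\<psi> \<in> Hom C w z. hzero C z x \<cdot> \<psi> = \<phi>" if "\<phi> = hzero C w x" "w \<in> Obj C" "x \<in> Obj C" for w \<phi> x
    using that hzero_closed[OF that(2) o(4)] hzero_cmp by blast
  have desc: "\<exists>\<psi> \<in> Hom C z w. \<psi> \<cdot> hzero C x z = \<phi>" if "\<phi> = hzero C x w" "w \<in> Obj C" "x \<in> Obj C" for w \<phi> x
    using that hzero_closed[OF o(4) that(2)] cmp_hzero by blast
  have "is_cokernel C (ident C a) (hzero C z a)"
  proof (rule is_cokernelI[OF za ida])
    show "ident C a \<cdot> hzero C z a = hzero C z a" using ident_cmp[OF za] .
  qed (use cmp_ident in blast, use cmp_ident in metis)
  moreover have "is_kernel C (hzero C z a) (ident C a)"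
  proof (rule is_kernelI[OF za ida])
    show "ident C a \<cdot> hzero C z a = hzero C z a" using ident_cmp[OF za] .
    show "\<exists>\<psi> \<in> Hom C w z. hzero C z a \<cdot> \<psi> = \<phi>"
      if "\<phi> \<in> Hom C w a" "ident C a \<cdot> \<phi> = hzero C w a" for w \<phi>
      using lift that ident_cmp[OF that(1)] Hom_Obj[OF that(1)] by metis
  qed (use to_z in blast)
  moreover have "is_kernel C (hzero C z a) f"
  proof (rule is_kernelI[OF za assms(1)])
    show "f \<cdot> hzero C z a = hzero C z b" using cmp_hzero[OF assms(1) o(4)] .
    show "\<exists>\<psi> \<in> Hom C w z. hzero C z a \<cdot> \<psi> = \<phi>"
      if "\<phi> \<in> Hom C w a" "f \<cdot> \<phi> = hzero C w b" for w \<phi>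
      using lift[OF mono[OF that]] Hom_Obj[OF that(1)] by blast
  qed (use to_z in blast)
  ultimately have 1: "exact_at C (hzero C z a) f"
    unfolding exact_at_def is_image_def by blast
  have "is_cokernel C (hzero C c z) g"
  proof (rule is_cokernelI[OF assms(2) cz])
    show "hzero C c z \<cdot> g = hzero C b z" using hzero_cmp[OF assms(2) o(4)] .
    show "\<exists>\<psi> \<in> Hom C z w. \<psi> \<cdot> hzero C c z = \<phi>"
      if "\<phi> \<in> Hom C c w" "\<phi> \<cdot> g = hzero C b w" for w \<phi>
      using desc[OF epi[OF that]] Hom_Obj[OF that(1)] by blast
  qed (use from_z in blast)
  moreover have "is_kernel C (ident C c) (hzero C c z)"
  proof (rule is_kernelI[OF idc cz])
    show "hzero C c z \<cdot> ident C c = hzero C c z" using cmp_ident[OF cz] .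
  qed (use ident_cmp in blast, use ident_cmp in metis)
  ultimately have 3: "exact_at C g (hzero C c z)"
    unfolding exact_at_def is_image_def by blast
  show ?thesis
    using z 1 3 assms(3,4) unfolding short_exact_def exact_at_def[of C f g] is_image_def d by blast
qed

lemma short_exact_iff:
  assumes "f \<in> Hom C a b" "g \<in> Hom C b c"
  shows "short_exact C f g \<longleftrightarrow> is_kernel C f g \<and> is_cokernel C g f"
  using short_exact_imp[OF assms] short_exactI[OF assms] by blast

end

section \<open>Full subcategories\<close>

lemma full_sub_simps [simp]:
  "Obj (full_sub C A) = A"
  "Dom (full_sub C A) = Dom C"
  "Cod (full_sub C A) = Cod C"
  "ident (full_sub C A) = ident C"
  "cmp (full_sub C A) = cmp C"
  by (simp_all add: full_sub_def)

lemma full_sub_preadd_simps [simp]: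
  fixes C :: "('o, 'm, 'e) preadd_scheme"
  shows "hadd (full_sub C A) = hadd C" "hzero (full_sub C A) = hzero C"
  by (simp_all add: full_sub_def)

lemma Hom_full_sub: "x \<in> A \<Longrightarrow> y \<in> A \<Longrightarrow> Hom (full_sub C A) x y = Hom C x y"
  by (auto simp: Hom_def full_sub_def)

section \<open>Triangulated categories\<close>

lemma additive_functor_hzero:
  assumes "preadditive_category C" "preadditive_category D" "is_additive_functor C D F"
    and "x \<in> Obj C" "y \<in> Obj C"
  shows "fmor F (hzero C x y) = hzero D (fob F x) (fob F y)"
proof -
  interpret C: preadditive_category C by fact
  interpret D: preadditive_category D by fact
  have "fob F x \<in> Obj D" "fob F y \<in> Obj D"
    "fmor F \<in> hom (homgrp C x y) (homgrp D (fob F x) (fob F y))"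
    using assms(3-5) unfolding is_additive_functor_def is_functor_def by blast+
  then show ?thesis
    using hom_one[of "fmor F" "homgrp C x y" "homgrp D (fob F x) (fob F y)"]
      C.hom_group[OF assms(4,5)] D.hom_group by simp
qed

lemma additive_functor_hneg:
  assumes "preadditive_category C" "preadditive_category D" "is_additive_functor C D F"
    and "f \<in> Hom C x y"
  shows "fmor F (inv\<^bsub>homgrp C x y\<^esub> f) = inv\<^bsub>homgrp D (fob F x) (fob F y)\<^esub> (fmor F f)"
proof -
  interpret C: preadditive_category C by fact
  interpret D: preadditive_category D by fact
  note o = C.Hom_Obj[OF assms(4)]
  have "fob F x \<in> Obj D" "fob F y \<in> Obj D"
    "fmor F \<in> hom (homgrp C x y) (homgrp D (fob F x) (fob F y))"
    using assms(3) o unfolding is_additive_functor_def is_functor_def by blast+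
  then interpret group_hom "homgrp C x y" "homgrp D (fob F x) (fob F y)" "fmor F"
    using C.hom_group[OF o] D.hom_group by (simp add: group_hom_def group_hom_axioms_def)
  show ?thesis using hom_inv assms(4) by simp
qed

section \<open>The suspension as an autoequivalence\<close>

context triangulated_category
begin

abbreviation susp_ob ("\<Sigma>\<^sub>o") where "\<Sigma>\<^sub>o \<equiv> fob (susp T)"
abbreviation susp_mor ("\<Sigma>\<^sub>m") where "\<Sigma>\<^sub>m \<equiv> fmor (susp T)"
abbreviation desusp_ob ("\<Omega>\<^sub>o") where "\<Omega>\<^sub>o \<equiv> fob (desusp T)"
abbreviation desusp_mor ("\<Omega>\<^sub>m") where "\<Omega>\<^sub>m \<equiv> fmor (desusp T)"

lemma susp_Obj: "x \<in> Obj T \<Longrightarrow> \<Sigma>\<^sub>o x \<in> Obj T"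
  using susp_additive unfolding is_additive_functor_def is_functor_def by blast

lemma desusp_Obj: "x \<in> Obj T \<Longrightarrow> \<Omega>\<^sub>o x \<in> Obj T"
  using desusp_additive unfolding is_additive_functor_def is_functor_def by blast

lemma susp_Hom: "f \<in> Hom T x y \<Longrightarrow> \<Sigma>\<^sub>m f \<in> Hom T (\<Sigma>\<^sub>o x) (\<Sigma>\<^sub>o y)"
  using susp_additive Hom_Obj unfolding is_additive_functor_def is_functor_def by blast

lemma desusp_Hom: "f \<in> Hom T x y \<Longrightarrow> \<Omega>\<^sub>m f \<in> Hom T (\<Omega>\<^sub>o x) (\<Omega>\<^sub>o y)"
  using desusp_additive Hom_Obj unfolding is_additive_functor_def is_functor_def by blast

lemma susp_cmp:
  assumes "f \<in> Hom T x y" "g \<in> Hom T y z"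
  shows "\<Sigma>\<^sub>m (g \<cdot> f) = \<Sigma>\<^sub>m g \<cdot> \<Sigma>\<^sub>m f"
  using susp_additive assms Hom_Obj[OF assms(1)] Hom_Obj[OF assms(2)]
  unfolding is_additive_functor_def is_functor_def by blast

lemma susp_ident: "x \<in> Obj T \<Longrightarrow> \<Sigma>\<^sub>m (ident T x) = ident T (\<Sigma>\<^sub>o x)"
  using susp_additive unfolding is_additive_functor_def is_functor_def by blast

lemmas susp_hzero =
  additive_functor_hzero[OF preadditive_category_axioms preadditive_category_axioms susp_additive]
lemmas desusp_hzero =
  additive_functor_hzero[OF preadditive_category_axioms preadditive_category_axioms desusp_additive]
lemmas susp_hneg =
  additive_functor_hneg[OF preadditive_category_axioms preadditive_category_axioms susp_additive]

lemma susp_zero_object: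
  assumes "zero_object T z"
  shows "zero_object T (\<Sigma>\<^sub>o z)"
proof (rule zero_objectI)
  have z: "z \<in> Obj T" using assms by (simp add: zero_object_def)
  show "\<Sigma>\<^sub>o z \<in> Obj T" using susp_Obj[OF z] .
  show "ident T (\<Sigma>\<^sub>o z) = hzero T (\<Sigma>\<^sub>o z) (\<Sigma>\<^sub>o z)"
    using susp_ident[OF z] susp_hzero[OF z z] zero_object_ident[OF assms] by simp
qed

lemma unit1_Hom:
  assumes "x \<in> Obj T"
  shows "unit\<^sub>1 T x \<in> Hom T x (\<Omega>\<^sub>o (\<Sigma>\<^sub>o x))" "isomorphism T (unit\<^sub>1 T x)"
  using natural_iso_id_Hom[OF unit\<^sub>1_iso assms] by (simp_all add: comp_ftor_def)

lemma unit2_Hom: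
  assumes "x \<in> Obj T"
  shows "unit\<^sub>2 T x \<in> Hom T x (\<Sigma>\<^sub>o (\<Omega>\<^sub>o x))" "isomorphism T (unit\<^sub>2 T x)"
  using natural_iso_id_Hom[OF unit\<^sub>2_iso assms] by (simp_all add: comp_ftor_def)

lemma unit1_naturality: "f \<in> Hom T x y \<Longrightarrow> unit\<^sub>1 T y \<cdot> f = \<Omega>\<^sub>m (\<Sigma>\<^sub>m f) \<cdot> unit\<^sub>1 T x"
  using natural_iso_id_naturality[OF unit\<^sub>1_iso] by (simp add: comp_ftor_def)

lemma unit2_naturality: "f \<in> Hom T x y \<Longrightarrow> unit\<^sub>2 T y \<cdot> f = \<Sigma>\<^sub>m (\<Omega>\<^sub>m f) \<cdot> unit\<^sub>2 T x"
  using natural_iso_id_naturality[OF unit\<^sub>2_iso] by (simp add: comp_ftor_def)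

lemma susp_faithful: "f \<in> Hom T x y \<Longrightarrow> g \<in> Hom T x y \<Longrightarrow> \<Sigma>\<^sub>m f = \<Sigma>\<^sub>m g \<Longrightarrow> f = g"
  using natural_iso_id_faithful[OF unit\<^sub>1_iso] by (simp add: comp_ftor_def)

lemma desusp_faithful: "f \<in> Hom T x y \<Longrightarrow> g \<in> Hom T x y \<Longrightarrow> \<Omega>\<^sub>m f = \<Omega>\<^sub>m g \<Longrightarrow> f = g"
  using natural_iso_id_faithful[OF unit\<^sub>2_iso] by (simp add: comp_ftor_def)

text \<open>The desuspension of \<open>r\<close> is transported along the units to a morphism \<psi>
  from \<open>x\<close> to \<open>y\<close>. Naturality shows that \<open>r\<close> and the
  suspension of \<psi> have equal desuspensions, and the desuspension is faithful.\<close>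

lemma susp_full:
  assumes r: "r \<in> Hom T (\<Sigma>\<^sub>o x) (\<Sigma>\<^sub>o y)" and x: "x \<in> Obj T" and y: "y \<in> Obj T"
  obtains \<psi> where "\<psi> \<in> Hom T x y" "\<Sigma>\<^sub>m \<psi> = r"
proof -
  note ux = unit1_Hom[OF x] and uy = unit1_Hom[OF y]
  obtain v where v: "v \<in> Hom T (\<Omega>\<^sub>o (\<Sigma>\<^sub>o y)) y" "unit\<^sub>1 T y \<cdot> v = ident T (\<Omega>\<^sub>o (\<Sigma>\<^sub>o y))"
    using isomorphism_inverse[OF uy(2,1)] by metis
  obtain w where w: "w \<in> Hom T (\<Omega>\<^sub>o (\<Sigma>\<^sub>o x)) x" "unit\<^sub>1 T x \<cdot> w = ident T (\<Omega>\<^sub>o (\<Sigma>\<^sub>o x))"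
    using isomorphism_inverse[OF ux(2,1)] by metis
  note r' = desusp_Hom[OF r]
  note ru = cmp_closed[OF ux(1) r']
  define \<psi> where "\<psi> = v \<cdot> (\<Omega>\<^sub>m r \<cdot> unit\<^sub>1 T x)"
  have \<psi>: "\<psi> \<in> Hom T x y"
    unfolding \<psi>_def using cmp_closed[OF ru v(1)] .
  note \<psi>' = desusp_Hom[OF susp_Hom[OF \<psi>]]
  have "\<Omega>\<^sub>m (\<Sigma>\<^sub>m \<psi>) \<cdot> unit\<^sub>1 T x = unit\<^sub>1 T y \<cdot> \<psi>"
    using unit1_naturality[OF \<psi>] by simp
  also have "\<dots> = \<Omega>\<^sub>m r \<cdot> unit\<^sub>1 T x"
    unfolding \<psi>_def using cmp_assoc[OF ru v(1) uy(1)] v(2) ident_cmp[OF ru] by simp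
  finally have "\<Omega>\<^sub>m (\<Sigma>\<^sub>m \<psi>) = \<Omega>\<^sub>m r"
    using cmp_assoc[OF w(1) ux(1) r'] cmp_assoc[OF w(1) ux(1) \<psi>'] w(2)
      cmp_ident[OF r'] cmp_ident[OF \<psi>'] by simp
  then have "\<Sigma>\<^sub>m \<psi> = r" using desusp_faithful[OF susp_Hom[OF \<psi>] r] by blast
  then show ?thesis using \<psi> that by blast
qed

text \<open>Converts the hypothesis on morphisms into a desuspension into one on morphisms out of a
  suspension. The desuspension of \<phi>, composed with the unit of \<open>x\<close>, lies in a zero
  Hom group; the unit cancels and the desuspension is faithful.\<close>

lemma Hom_susp_zero:
  assumes "x \<in> Obj T" "Hom T x (\<Omega>\<^sub>o y) = {hzero T x (\<Omega>\<^sub>o y)}" "\<phi> \<in> Hom T (\<Sigma>\<^sub>o x) y"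
  shows "\<phi> = hzero T (\<Sigma>\<^sub>o x) y"
proof -
  have y: "y \<in> Obj T" using Hom_Obj assms(3) by blast
  note u = unit1_Hom[OF assms(1)]
  note \<phi> = desusp_Hom[OF assms(3)]
  obtain w where w: "w \<in> Hom T (\<Omega>\<^sub>o (\<Sigma>\<^sub>o x)) x" "unit\<^sub>1 T x \<cdot> w = ident T (\<Omega>\<^sub>o (\<Sigma>\<^sub>o x))"
    using isomorphism_inverse[OF u(2,1)] by metis
  have "\<Omega>\<^sub>m \<phi> \<cdot> unit\<^sub>1 T x = hzero T x (\<Omega>\<^sub>o y)"
    using cmp_closed[OF u(1) \<phi>] assms(2) by blast
  then have "\<Omega>\<^sub>m \<phi> = hzero T (\<Omega>\<^sub>o (\<Sigma>\<^sub>o x)) (\<Omega>\<^sub>o y)"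
    using cmp_assoc[OF w(1) u(1) \<phi>] w(2) cmp_ident[OF \<phi>] hzero_cmp[OF w(1) desusp_Obj[OF y]]
    by simp
  also have "\<dots> = \<Omega>\<^sub>m (hzero T (\<Sigma>\<^sub>o x) y)"
    using desusp_hzero[OF susp_Obj[OF assms(1)] y] by simp
  finally show ?thesis
    using desusp_faithful[OF assms(3)] hzero_closed[OF susp_Obj[OF assms(1)] y] by blast
qed

section \<open>Distinguished triangles, weak kernels and weak cokernels\<close>

lemma dist_triangleD:
  assumes "dist_triangle T x y z f g h"
  shows "x \<in> Obj T" "y \<in> Obj T" "z \<in> Obj T" "f \<in> Hom T x y" "g \<in> Hom T y z"
    "h \<in> Hom T z (\<Sigma>\<^sub>o x)"
  using assms by (auto simp: dist_triangle_def)

lemma dist_triangle_rotate: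
  assumes "dist_triangle T x y z f g h"
  shows "dist_triangle T y z (\<Sigma>\<^sub>o x) g h (hneg (\<Sigma>\<^sub>o x) (\<Sigma>\<^sub>o y) (\<Sigma>\<^sub>m f))"
  using assms tri_rotate[of x y z f g h] dist_triangleD[OF assms] by blast

lemma dist_triangle_cmp_zero:
  assumes "dist_triangle T x y z f g h"
  shows "g \<cdot> f = hzero T x z"
proof -
  note d = dist_triangleD[OF assms]
  obtain o' where o': "zero_object T o'" using ex_zero_object by blast
  \<comment> \<open>TR3 compares the identity triangle on \<open>x\<close> with the given one along
    the identity and \<open>f\<close>, so \<open>g \<cdot> f\<close> factors through the zero
    object.\<close>
  obtain r where r: "r \<in> Hom T o' z" "r \<cdot> hzero T x o' = g \<cdot> f"
    using tri_morphism[OF tri_ident[OF d(1) o'] assms ident_closed[OF d(1)] d(4)] by blast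
  then show ?thesis using cmp_hzero[OF r(1) d(1)] by simp
qed

text \<open>The required \<psi> is the third component of a morphism to the triangle on
  \<open>o'\<close>, \<open>w\<close>, \<open>w\<close> whose middle morphism is an identity; TR3
  supplies it.\<close>

lemma dist_triangle_weak_cokernel:
  assumes "dist_triangle T x y z f g h" "\<phi> \<in> Hom T y w" "\<phi> \<cdot> f = hzero T x w"
  obtains \<psi> where "\<psi> \<in> Hom T z w" "\<psi> \<cdot> g = \<phi>"
proof -
  note d = dist_triangleD[OF assms(1)]
  have w: "w \<in> Obj T" using Hom_Obj assms(2) by blast
  obtain o' where o': "zero_object T o'" using ex_zero_object by blast
  then have ob: "o' \<in> Obj T" by (simp add: zero_object_def)
  note s = susp_zero_object[OF o']
  \<comment> \<open>The target triangle is the identity triangle on \<open>w\<close>, with the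
    suspension of \<open>o'\<close> as its zero object, rotated backwards. The sign from the
    rotation disappears because the morphism starts at a zero object.\<close>
  have "hneg (\<Sigma>\<^sub>o o') (\<Sigma>\<^sub>o w) (\<Sigma>\<^sub>m (hzero T o' w)) = hzero T (\<Sigma>\<^sub>o o') (\<Sigma>\<^sub>o w)"
    using zero_object_Hom(2)[OF s susp_Obj[OF w]] hneg_closed[OF susp_Hom[OF hzero_closed[OF ob w]]]
    by blast
  then have "dist_triangle T o' w w (hzero T o' w) (ident T w) (hzero T w (\<Sigma>\<^sub>o o'))"
    using tri_rotate[OF ob w w hzero_closed[OF ob w] ident_closed[OF w] hzero_closed[OF w susp_Obj[OF ob]]]
      tri_ident[OF w s] by simp
  from tri_morphism[OF assms(1) this hzero_closed[OF d(1) ob] assms(2)]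
  obtain r where "r \<in> Hom T z w" "r \<cdot> g = ident T w \<cdot> \<phi>"
    using assms(3) cmp_hzero[OF hzero_closed[OF ob w] d(1)] by auto
  then show ?thesis using that ident_cmp[OF assms(2)] by simp
qed

text \<open>TR3 fills in only the third component, so both triangles are rotated to bring the
  unknown there. It appears suspended, as \<open>r\<close>, and is recovered because the suspension
  is full and faithful.\<close>

lemma dist_triangle_weak_kernel:
  assumes "dist_triangle T x y z f g h" "\<phi> \<in> Hom T w y" "g \<cdot> \<phi> = hzero T w z"
  obtains \<psi> where "\<psi> \<in> Hom T w x" "f \<cdot> \<psi> = \<phi>"
proof -
  note d = dist_triangleD[OF assms(1)]
  have w: "w \<in> Obj T" using Hom_Obj assms(2) by blast
  obtain o' where o': "zero_object T o'" using ex_zero_object by blast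
  then have ob: "o' \<in> Obj T" by (simp add: zero_object_def)
  note sw = susp_Obj[OF w] and ids = ident_closed[OF susp_Obj[OF w]]
  from tri_morphism[OF dist_triangle_rotate[OF tri_ident[OF w o']] dist_triangle_rotate[OF assms(1)]
      assms(2) hzero_closed[OF ob d(3)]]
  obtain r where r: "r \<in> Hom T (\<Sigma>\<^sub>o w) (\<Sigma>\<^sub>o x)"
    "\<Sigma>\<^sub>m \<phi> \<cdot> hneg (\<Sigma>\<^sub>o w) (\<Sigma>\<^sub>o w) (\<Sigma>\<^sub>m (ident T w)) = hneg (\<Sigma>\<^sub>o x) (\<Sigma>\<^sub>o y) (\<Sigma>\<^sub>m f) \<cdot> r"
    using hzero_cmp[OF hzero_closed[OF w ob] d(3)] assms(3) by auto
  obtain \<psi> where \<psi>: "\<psi> \<in> Hom T w x" "\<Sigma>\<^sub>m \<psi> = r" using susp_full[OF r(1) w d(1)] by blast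
  note s\<phi> = susp_Hom[OF assms(2)]
  \<comment> \<open>Rotation put a minus sign on both sides; the signs cancel.\<close>
  have "hneg (\<Sigma>\<^sub>o w) (\<Sigma>\<^sub>o y) (\<Sigma>\<^sub>m \<phi>) = hneg (\<Sigma>\<^sub>o w) (\<Sigma>\<^sub>o y) (\<Sigma>\<^sub>m f \<cdot> r)"
    using r(2) cmp_hneg[OF ids s\<phi>] hneg_cmp[OF r(1) susp_Hom[OF d(4)]] susp_ident[OF w]
      cmp_ident[OF s\<phi>] by simp
  then have "\<Sigma>\<^sub>m \<phi> = \<Sigma>\<^sub>m f \<cdot> r"
    using hneg_eq_iff[OF s\<phi> cmp_closed[OF r(1) susp_Hom[OF d(4)]]] by simp
  then have "\<Sigma>\<^sub>m (f \<cdot> \<psi>) = \<Sigma>\<^sub>m \<phi>" using susp_cmp[OF \<psi>(1) d(4)] \<psi>(2) by simp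
  then show ?thesis
    using susp_faithful[OF cmp_closed[OF \<psi>(1) d(4)] assms(2)] \<psi>(1) that by blast
qed

text \<open>TR1 is applied to the negative of the desuspension of \<open>g\<close>. One rotation
  cancels the sign and moves this morphism to the last place, where the unit replaces the suspended
  desuspension of \<open>y\<close> by \<open>y\<close>.\<close>

lemma ex_dist_triangle_desusp:
  assumes "g \<in> Hom T y z"
  obtains x u f where "dist_triangle_desusp T x y z u f g"
proof -
  note o = Hom_Obj[OF assms]
  note oy = desusp_Obj[OF o(1)] and oz = desusp_Obj[OF o(2)]
  define k where "k = hneg (\<Omega>\<^sub>o y) (\<Omega>\<^sub>o z) (\<Omega>\<^sub>m g)"
  have k: "k \<in> Hom T (\<Omega>\<^sub>o y) (\<Omega>\<^sub>o z)" unfolding k_def using hneg_closed[OF desusp_Hom[OF assms]] .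
  obtain x u v where t: "dist_triangle T (\<Omega>\<^sub>o y) (\<Omega>\<^sub>o z) x k u v"
    using tri_ex[OF oy oz k] by blast
  note d = dist_triangleD[OF t]
  have "hneg (\<Sigma>\<^sub>o (\<Omega>\<^sub>o y)) (\<Sigma>\<^sub>o (\<Omega>\<^sub>o z)) (\<Sigma>\<^sub>m k) = \<Sigma>\<^sub>m (\<Omega>\<^sub>m g)"
    unfolding k_def using susp_hneg[OF desusp_Hom[OF assms]]
      hneg_hneg[OF susp_Hom[OF desusp_Hom[OF assms]]] by simp
  with dist_triangle_rotate[OF t]
  have t': "dist_triangle T (\<Omega>\<^sub>o z) x (\<Sigma>\<^sub>o (\<Omega>\<^sub>o y)) u v (\<Sigma>\<^sub>m (\<Omega>\<^sub>m g))" by simp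
  note uy = unit2_Hom[OF o(1)] and uz = unit2_Hom[OF o(2)]
  obtain r where r: "r \<in> Hom T (\<Sigma>\<^sub>o (\<Omega>\<^sub>o y)) y" "r \<cdot> unit\<^sub>2 T y = ident T y"
      "unit\<^sub>2 T y \<cdot> r = ident T (\<Sigma>\<^sub>o (\<Omega>\<^sub>o y))"
    using isomorphism_inverse[OF uy(2,1)] by metis
  have ri: "isomorphism T r" using isomorphismI[OF r(1) uy(1) r(3,2)] .
  note sg = susp_Hom[OF desusp_Hom[OF assms]]
  \<comment> \<open>Naturality of the unit, with the unit of \<open>y\<close> moved across as its
    inverse \<open>r\<close>; this is the last square required by \<open>tri_iso\<close>.\<close>
  have "(unit\<^sub>2 T z \<cdot> g) \<cdot> r = \<Sigma>\<^sub>m (\<Omega>\<^sub>m g)"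
    using unit2_naturality[OF assms] cmp_assoc[OF r(1) uy(1) sg] r(3) cmp_ident[OF sg] by simp
  then have "dist_triangle T (\<Omega>\<^sub>o z) x y u (r \<cdot> v) (unit\<^sub>2 T z \<cdot> g)"
    using tri_iso[OF t' d(5) cmp_closed[OF d(6) r(1)] cmp_closed[OF assms uz(1)]
        ident_closed[OF oz] ident_closed[OF d(3)] r(1) isomorphism_ident[OF oz]
        isomorphism_ident[OF d(3)] ri]
      ident_cmp[OF d(5)] cmp_ident[OF d(5)] cmp_ident[OF cmp_closed[OF d(6) r(1)]]
      susp_ident[OF oz] ident_cmp[OF sg] by simp
  then have "dist_triangle_desusp T x y z u (r \<cdot> v) g"
    using assms o by (simp add: dist_triangle_desusp_def)
  then show ?thesis using that by blast
qed

text \<open>One rotation puts \<open>f\<close> first and \<open>unit\<^sub>2 T z \<cdot> g\<close>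
  second, and a morphism killed by \<open>g\<close> is killed by that composite.\<close>

lemma dist_triangle_desusp_weak_kernel:
  assumes "dist_triangle_desusp T x y z u f g" "\<phi> \<in> Hom T w y" "g \<cdot> \<phi> = hzero T w z"
  obtains \<psi> where "\<psi> \<in> Hom T w x" "f \<cdot> \<psi> = \<phi>"
proof -
  have t: "dist_triangle T (\<Omega>\<^sub>o z) x y u f (unit\<^sub>2 T z \<cdot> g)" and z: "z \<in> Obj T" and g: "g \<in> Hom T y z"
    using assms(1) by (auto simp: dist_triangle_desusp_def)
  note uz = unit2_Hom[OF z]
  have "(unit\<^sub>2 T z \<cdot> g) \<cdot> \<phi> = hzero T w (\<Sigma>\<^sub>o (\<Omega>\<^sub>o z))"
    using cmp_assoc[OF assms(2) g uz(1)] assms(3) cmp_hzero[OF uz(1)] Hom_Obj[OF assms(2)] by simp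
  then show ?thesis
    using dist_triangle_weak_kernel[OF dist_triangle_rotate[OF t] assms(2)] that by blast
qed

lemma dist_triangle_desusp_cmp_zero:
  assumes "dist_triangle_desusp T x y z u f g"
  shows "g \<cdot> f = hzero T x z"
proof -
  have t: "dist_triangle T (\<Omega>\<^sub>o z) x y u f (unit\<^sub>2 T z \<cdot> g)" and z: "z \<in> Obj T" and g: "g \<in> Hom T y z"
    using assms(1) by (auto simp: dist_triangle_desusp_def)
  note uz = unit2_Hom[OF z] and d = dist_triangleD[OF t]
  have "unit\<^sub>2 T z \<cdot> (g \<cdot> f) = unit\<^sub>2 T z \<cdot> hzero T x z"
    using cmp_assoc[OF d(5) g uz(1)] cmp_hzero[OF uz(1) d(2)]
      dist_triangle_cmp_zero[OF dist_triangle_rotate[OF t]] by simp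
  then show ?thesis
    using isomorphism_cancel[OF uz(2,1) cmp_closed[OF d(5) g] hzero_closed[OF d(2) z]] by blast
qed

section \<open>Strong envelopes and cokernels, strong covers and kernels\<close>

text \<open>For \<open>y\<close> in \<open>A\<close>, composition with \<open>g'\<close> identifies
  \<open>Hom T z y\<close> with the morphisms from \<open>b\<close> to \<open>y\<close> that kill
  \<open>f\<close>. Under this identification composition with \<eta> becomes composition with
  \<open>g\<close>, so its bijectivity is the universal property of a cokernel tested on
  \<open>A\<close>.\<close>

lemma strong_envelope_iff_cokernel:
  assumes sub: "A \<subseteq> Obj T" "preadditive_category (full_sub T A)"
    and A: "a \<in> A" "b \<in> A" "c \<in> A"
    and vanish: "\<And>y. y \<in> A \<Longrightarrow> Hom T a (\<Omega>\<^sub>o y) = {hzero T a (\<Omega>\<^sub>o y)}"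
    and t: "dist_triangle T a b z f g' h"
    and \<eta>: "\<eta> \<in> Hom T z c" "\<eta> \<cdot> g' = g"
  shows "strong_envelope T A z c \<eta> \<longleftrightarrow> is_cokernel (full_sub T A) g f"
proof -
  interpret F: preadditive_category "full_sub T A" by fact
  note d = dist_triangleD[OF t]
  have g: "g \<in> Hom T b c" using cmp_closed[OF d(5) \<eta>(1)] \<eta>(2) by simp
  have fF: "f \<in> Hom (full_sub T A) a b" and gF: "g \<in> Hom (full_sub T A) b c"
    using d(4) g A by (simp_all add: Hom_full_sub)
  \<comment> \<open>The vanishing hypothesis enters here: a morphism \<open>k\<close> killed by
    \<open>g'\<close> factors through the suspension of \<open>a\<close>, from which only zero
    reaches \<open>y\<close>.\<close>
  have g'_epi: "\<phi> = \<psi>" if "y \<in> A" "\<phi> \<in> Hom T z y" "\<psi> \<in> Hom T z y" "\<phi> \<cdot> g' = \<psi> \<cdot> g'" for y \<phi> \<psi>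
  proof (rule precomp_cancel[OF d(5) that(2-4)])
    fix k assume k: "k \<in> Hom T z y" "k \<cdot> g' = hzero T b y"
    obtain \<chi> where \<chi>: "\<chi> \<in> Hom T (\<Sigma>\<^sub>o a) y" "\<chi> \<cdot> h = k"
      using dist_triangle_weak_cokernel[OF dist_triangle_rotate[OF t] k] by blast
    then show "k = hzero T z y"
      using Hom_susp_zero[OF d(1) vanish[OF that(1)] \<chi>(1)] hzero_cmp[OF d(6) Hom_Obj(2)[OF k(1)]]
      by simp
  qed
  have gf: "g \<cdot> f = hzero T a c"
    using cmp_assoc[OF d(4,5) \<eta>(1)] \<eta>(2) dist_triangle_cmp_zero[OF t] cmp_hzero[OF \<eta>(1) d(1)]
    by simp
  have \<eta>g': "(\<chi> \<cdot> \<eta>) \<cdot> g' = \<chi> \<cdot> g" if "\<chi> \<in> Hom T c y" for \<chi> y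
    using cmp_assoc[OF d(5) \<eta>(1) that] \<eta>(2) by simp
  show ?thesis
  proof
    assume "strong_envelope T A z c \<eta>"
    then have bij: "bij_betw (\<lambda>h. h \<cdot> \<eta>) (Hom T c y) (Hom T z y)" if "y \<in> A" for y
      using that by (auto simp: strong_envelope_def iso_def)
    show "is_cokernel (full_sub T A) g f"
    proof (rule F.is_cokernelI[OF fF gF])
      fix w \<phi> assume w: "\<phi> \<in> Hom (full_sub T A) b w" "\<phi> \<cdot>\<^bsub>full_sub T A\<^esub> f = hzero (full_sub T A) a w"
      have wA: "w \<in> A" using F.Hom_Obj(2)[OF w(1)] by simp
      then have w': "\<phi> \<in> Hom T b w" "\<phi> \<cdot> f = hzero T a w" using w A by (simp_all add: Hom_full_sub)
      obtain \<psi> where \<psi>: "\<psi> \<in> Hom T z w" "\<psi> \<cdot> g' = \<phi>"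
        using dist_triangle_weak_cokernel[OF t w'] by blast
      obtain \<chi> where \<chi>: "\<chi> \<in> Hom T c w" "\<chi> \<cdot> \<eta> = \<psi>"
        using bij_betw_imp_surj_on[OF bij[OF wA]] \<psi>(1) by (metis imageE)
      then show "\<exists>\<psi> \<in> Hom (full_sub T A) c w. \<psi> \<cdot>\<^bsub>full_sub T A\<^esub> g = \<phi>"
        using \<eta>g'[OF \<chi>(1)] \<psi>(2) A wA by (auto simp: Hom_full_sub)
    next
      fix w \<psi> assume w: "\<psi> \<in> Hom (full_sub T A) c w" "\<psi> \<cdot>\<^bsub>full_sub T A\<^esub> g = hzero (full_sub T A) b w"
      have wA: "w \<in> A" using F.Hom_Obj(2)[OF w(1)] by simp
      then have w': "\<psi> \<in> Hom T c w" "\<psi> \<cdot> g = hzero T b w" using w A by (simp_all add: Hom_full_sub)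
      have wo: "w \<in> Obj T" "c \<in> Obj T" using wA A sub by auto
      \<comment> \<open>Both sides become zero after composition with \<open>g'\<close>; injectivity
        of composition with \<eta> then gives that \<psi> is zero.\<close>
      have "\<psi> \<cdot> \<eta> = hzero T c w \<cdot> \<eta>"
        using g'_epi[OF wA cmp_closed[OF \<eta>(1) w'(1)] cmp_closed[OF \<eta>(1) hzero_closed[OF wo(2,1)]]]
          \<eta>g'[OF w'(1)] \<eta>g'[OF hzero_closed[OF wo(2,1)]] w'(2) hzero_cmp[OF g wo(1)] by simp
      then show "\<psi> = hzero (full_sub T A) c w"
        using bij_betw_imp_inj_on[OF bij[OF wA]] w'(1) hzero_closed[OF wo(2,1)]
        by (auto dest: inj_onD)
    qed (use gf in simp)
  next
    assume coker: "is_cokernel (full_sub T A) g f"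
    obtain c' where c': "g \<in> Hom (full_sub T A) b c'"
      "\<And>w \<phi>. \<phi> \<in> Hom (full_sub T A) b w \<Longrightarrow> \<phi> \<cdot>\<^bsub>full_sub T A\<^esub> f = hzero (full_sub T A) a w \<Longrightarrow>
        \<exists>\<psi> \<in> Hom (full_sub T A) c' w. \<psi> \<cdot>\<^bsub>full_sub T A\<^esub> g = \<phi>"
      "\<And>w \<psi>. \<psi> \<in> Hom (full_sub T A) c' w \<Longrightarrow> \<psi> \<cdot>\<^bsub>full_sub T A\<^esub> g = hzero (full_sub T A) b w \<Longrightarrow>
        \<psi> = hzero (full_sub T A) c' w"
      using F.is_cokernelE[OF coker fF] by metis
    have cc: "c' = c" using HomD(3)[OF c'(1)] HomD(3)[OF gF] by simp
    have "(\<lambda>h. h \<cdot> \<eta>) \<in> iso (homgrp T c y) (homgrp T z y)" if y: "y \<in> A" for y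
    proof -
      have yo: "y \<in> Obj T" using y sub by auto
      have "\<phi> = \<psi>" if "\<phi> \<in> Hom T c y" "\<psi> \<in> Hom T c y" "\<phi> \<cdot> \<eta> = \<psi> \<cdot> \<eta>" for \<phi> \<psi>
      proof (rule precomp_cancel[OF \<eta>(1) that])
        fix k assume k: "k \<in> Hom T c y" "k \<cdot> \<eta> = hzero T z y"
        have "k \<cdot> g = hzero T b y"
          using \<eta>g'[OF k(1)] k(2) hzero_cmp[OF d(5) yo] by simp
        then show "k = hzero T c y" using c'(3)[of k y] k(1) y A cc by (simp add: Hom_full_sub)
      qed
      moreover have "\<exists>\<chi> \<in> Hom T c y. \<chi> \<cdot> \<eta> = \<phi>" if \<phi>: "\<phi> \<in> Hom T z y" for \<phi>
      proof -
        \<comment> \<open>So \<phi> restricted along \<open>g'\<close> descends to some \<chi> along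
          the cokernel \<open>g\<close>. Then \<chi> composed with \<eta> agrees with \<phi> after
          \<open>g'\<close>, and \<open>g'_epi\<close> makes them equal.\<close>
        have "(\<phi> \<cdot> g') \<cdot> f = hzero T a y"
          using cmp_assoc[OF d(4,5) \<phi>] dist_triangle_cmp_zero[OF t] cmp_hzero[OF \<phi> d(1)] by simp
        then obtain \<chi> where \<chi>: "\<chi> \<in> Hom T c y" "\<chi> \<cdot> g = \<phi> \<cdot> g'"
          using c'(2)[of "\<phi> \<cdot> g'" y] cmp_closed[OF d(5) \<phi>] y A cc by (auto simp: Hom_full_sub)
        then have "\<chi> \<cdot> \<eta> = \<phi>"
          using g'_epi[OF y cmp_closed[OF \<eta>(1) \<chi>(1)] \<phi>] \<eta>g'[OF \<chi>(1)] by simp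
        then show ?thesis using \<chi>(1) by blast
      qed
      ultimately have "bij_betw (\<lambda>h. h \<cdot> \<eta>) (Hom T c y) (Hom T z y)"
        using cmp_closed[OF \<eta>(1)] by (intro bij_betwI') metis+
      then show ?thesis using precomp_hom[OF \<eta>(1) yo] by (simp add: iso_def)
    qed
    then show "strong_envelope T A z c \<eta>" using A \<eta>(1) by (simp add: strong_envelope_def)
  qed
qed

text \<open>Dually, composition with \<open>f'\<close> identifies \<open>Hom T y x\<close> with the
  morphisms from \<open>y\<close> to \<open>b\<close> killed by \<open>g\<close>, and turns
  composition with \<epsilon> into composition with \<open>f\<close>.\<close>

lemma strong_cover_iff_kernel:
  assumes sub: "A \<subseteq> Obj T" "preadditive_category (full_sub T A)"
    and A: "a \<in> A" "b \<in> A" "c \<in> A"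
    and vanish: "\<And>y. y \<in> A \<Longrightarrow> Hom T y (\<Omega>\<^sub>o c) = {hzero T y (\<Omega>\<^sub>o c)}"
    and t: "dist_triangle_desusp T x b c u f' g"
    and \<epsilon>: "\<epsilon> \<in> Hom T a x" "f' \<cdot> \<epsilon> = f"
  shows "strong_cover T A a x \<epsilon> \<longleftrightarrow> is_kernel (full_sub T A) f g"
proof -
  interpret F: preadditive_category "full_sub T A" by fact
  have t': "dist_triangle T (\<Omega>\<^sub>o c) x b u f' (unit\<^sub>2 T c \<cdot> g)" and g: "g \<in> Hom T b c"
    using t by (auto simp: dist_triangle_desusp_def)
  note d = dist_triangleD[OF t']
  have f: "f \<in> Hom T a b" using cmp_closed[OF \<epsilon>(1) d(5)] \<epsilon>(2) by simp
  have o: "a \<in> Obj T" "b \<in> Obj T" "c \<in> Obj T" using A sub by auto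
  have fF: "f \<in> Hom (full_sub T A) a b" and gF: "g \<in> Hom (full_sub T A) b c"
    using f g A by (simp_all add: Hom_full_sub)
  \<comment> \<open>A morphism killed by \<open>f'\<close> factors through the desuspension of
    \<open>c\<close>, so the vanishing hypothesis applies directly.\<close>
  have f'_mono: "\<phi> = \<psi>" if "y \<in> A" "\<phi> \<in> Hom T y x" "\<psi> \<in> Hom T y x" "f' \<cdot> \<phi> = f' \<cdot> \<psi>" for y \<phi> \<psi>
  proof (rule postcomp_cancel[OF d(5) that(2-4)])
    fix k assume k: "k \<in> Hom T y x" "f' \<cdot> k = hzero T y b"
    obtain \<chi> where \<chi>: "\<chi> \<in> Hom T y (\<Omega>\<^sub>o c)" "u \<cdot> \<chi> = k"
      using dist_triangle_weak_kernel[OF t' k] by blast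
    then show "k = hzero T y x"
      using vanish[OF that(1)] cmp_hzero[OF d(4) Hom_Obj(1)[OF k(1)]] by simp
  qed
  have gf: "g \<cdot> f = hzero T a c"
    using cmp_assoc[OF \<epsilon>(1) d(5) g] \<epsilon>(2) dist_triangle_desusp_cmp_zero[OF t] hzero_cmp[OF \<epsilon>(1) o(3)]
    by simp
  have f'\<epsilon>: "f' \<cdot> (\<epsilon> \<cdot> \<chi>) = f \<cdot> \<chi>" if "\<chi> \<in> Hom T y a" for \<chi> y
    using cmp_assoc[OF that \<epsilon>(1) d(5)] \<epsilon>(2) by simp
  show ?thesis
  proof
    assume "strong_cover T A a x \<epsilon>"
    then have bij: "bij_betw (\<lambda>h. \<epsilon> \<cdot> h) (Hom T y a) (Hom T y x)" if "y \<in> A" for y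
      using that by (auto simp: strong_cover_def iso_def)
    show "is_kernel (full_sub T A) f g"
    proof (rule F.is_kernelI[OF fF gF])
      fix w \<phi> assume w: "\<phi> \<in> Hom (full_sub T A) w b" "g \<cdot>\<^bsub>full_sub T A\<^esub> \<phi> = hzero (full_sub T A) w c"
      have wA: "w \<in> A" using F.Hom_Obj(1)[OF w(1)] by simp
      then have w': "\<phi> \<in> Hom T w b" "g \<cdot> \<phi> = hzero T w c" using w A by (simp_all add: Hom_full_sub)
      obtain \<psi> where \<psi>: "\<psi> \<in> Hom T w x" "f' \<cdot> \<psi> = \<phi>"
        using dist_triangle_desusp_weak_kernel[OF t w'] by blast
      obtain \<chi> where \<chi>: "\<chi> \<in> Hom T w a" "\<epsilon> \<cdot> \<chi> = \<psi>"
        using bij_betw_imp_surj_on[OF bij[OF wA]] \<psi>(1) by (metis imageE)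
      then show "\<exists>\<psi> \<in> Hom (full_sub T A) w a. f \<cdot>\<^bsub>full_sub T A\<^esub> \<psi> = \<phi>"
        using f'\<epsilon>[OF \<chi>(1)] \<psi>(2) A wA by (auto simp: Hom_full_sub)
    next
      fix w \<psi> assume w: "\<psi> \<in> Hom (full_sub T A) w a" "f \<cdot>\<^bsub>full_sub T A\<^esub> \<psi> = hzero (full_sub T A) w b"
      have wA: "w \<in> A" using F.Hom_Obj(1)[OF w(1)] by simp
      then have w': "\<psi> \<in> Hom T w a" "f \<cdot> \<psi> = hzero T w b" using w A by (simp_all add: Hom_full_sub)
      have wo: "w \<in> Obj T" using wA sub by auto
      note 0 = hzero_closed[OF wo o(1)]
      have "\<epsilon> \<cdot> \<psi> = \<epsilon> \<cdot> hzero T w a"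
        using f'_mono[OF wA cmp_closed[OF w'(1) \<epsilon>(1)] cmp_closed[OF 0 \<epsilon>(1)]]
          f'\<epsilon>[OF w'(1)] f'\<epsilon>[OF 0] w'(2) cmp_hzero[OF f wo] by simp
      then show "\<psi> = hzero (full_sub T A) w a"
        using bij_betw_imp_inj_on[OF bij[OF wA]] w'(1) 0 by (auto dest: inj_onD)
    qed (use gf in simp)
  next
    assume ker: "is_kernel (full_sub T A) f g"
    obtain a' where a': "f \<in> Hom (full_sub T A) a' b"
      "\<And>w \<phi>. \<phi> \<in> Hom (full_sub T A) w b \<Longrightarrow> g \<cdot>\<^bsub>full_sub T A\<^esub> \<phi> = hzero (full_sub T A) w c \<Longrightarrow>
        \<exists>\<psi> \<in> Hom (full_sub T A) w a'. f \<cdot>\<^bsub>full_sub T A\<^esub> \<psi> = \<phi>"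
      "\<And>w \<psi>. \<psi> \<in> Hom (full_sub T A) w a' \<Longrightarrow> f \<cdot>\<^bsub>full_sub T A\<^esub> \<psi> = hzero (full_sub T A) w b \<Longrightarrow>
        \<psi> = hzero (full_sub T A) w a'"
      using F.is_kernelE[OF ker gF] by metis
    have aa: "a' = a" using HomD(2)[OF a'(1)] HomD(2)[OF fF] by simp
    have "(\<lambda>h. \<epsilon> \<cdot> h) \<in> iso (homgrp T y a) (homgrp T y x)" if y: "y \<in> A" for y
    proof -
      have yo: "y \<in> Obj T" using y sub by auto
      have "\<phi> = \<psi>" if "\<phi> \<in> Hom T y a" "\<psi> \<in> Hom T y a" "\<epsilon> \<cdot> \<phi> = \<epsilon> \<cdot> \<psi>" for \<phi> \<psi>
      proof (rule postcomp_cancel[OF \<epsilon>(1) that])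
        fix k assume k: "k \<in> Hom T y a" "\<epsilon> \<cdot> k = hzero T y x"
        have "f \<cdot> k = hzero T y b"
          using f'\<epsilon>[OF k(1)] k(2) cmp_hzero[OF d(5) yo] by simp
        then show "k = hzero T y a" using a'(3)[of k y] k(1) y A aa by (simp add: Hom_full_sub)
      qed
      moreover have "\<exists>\<chi> \<in> Hom T y a. \<epsilon> \<cdot> \<chi> = \<phi>" if \<phi>: "\<phi> \<in> Hom T y x" for \<phi>
      proof -
        \<comment> \<open>So \<open>f' \<cdot> \<phi>\<close> lifts along the kernel
          \<open>f\<close> to some \<chi>, and \<open>f'_mono\<close> shows that \<epsilon> carries
          \<chi> to \<phi>.\<close>
        have "g \<cdot> (f' \<cdot> \<phi>) = hzero T y c"
          using cmp_assoc[OF \<phi> d(5) g] dist_triangle_desusp_cmp_zero[OF t] hzero_cmp[OF \<phi> o(3)] by simp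
        then obtain \<chi> where \<chi>: "\<chi> \<in> Hom T y a" "f \<cdot> \<chi> = f' \<cdot> \<phi>"
          using a'(2)[of "f' \<cdot> \<phi>" y] cmp_closed[OF \<phi> d(5)] y A aa by (auto simp: Hom_full_sub)
        then have "\<epsilon> \<cdot> \<chi> = \<phi>"
          using f'_mono[OF y cmp_closed[OF \<chi>(1) \<epsilon>(1)] \<phi>] f'\<epsilon>[OF \<chi>(1)] by simp
        then show ?thesis using \<chi>(1) by blast
      qed
      ultimately have "bij_betw (\<lambda>h. \<epsilon> \<cdot> h) (Hom T y a) (Hom T y x)"
        using cmp_closed[OF _ \<epsilon>(1)] by (intro bij_betwI') metis+
      then show ?thesis using postcomp_hom[OF \<epsilon>(1) yo] by (simp add: iso_def)
    qed
    then show "strong_cover T A a x \<epsilon>" using A \<epsilon>(1) by (simp add: strong_cover_def)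
  qed
qed

end

section \<open>Short exact sequences in terms of triangles, strong covers and strong
  envelopes\<close>

theorem proposition1p10:
  fixes T :: "('o, 'm, 'e) triang_scheme"
    and A :: "'o set" and a b c :: 'o and f g :: 'm
  assumes "triangulated_category T"
    and "abelian_subcategory T A"
    and "\<And>x y. x \<in> A \<Longrightarrow> y \<in> A \<Longrightarrow>
           Hom T x (fob (desusp T) y) = {hzero T x (fob (desusp T) y)}"
    and "a \<in> A" and "b \<in> A" and "c \<in> A"
    and "f \<in> Hom T a b" and "g \<in> Hom T b c"
  shows "short_exact (full_sub T A) f g \<longleftrightarrow>
    (\<exists>z x g' h u f' \<epsilon> \<eta>.
       dist_triangle T a b z f g' h \<and>
       dist_triangle_desusp T x b c u f' g \<and>
       \<epsilon> \<in> Hom T a x \<and> \<eta> \<in> Hom T z c \<and>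
       f' \<cdot>\<^bsub>T\<^esub> \<epsilon> = f \<and> \<eta> \<cdot>\<^bsub>T\<^esub> g' = g \<and>
       strong_cover T A a x \<epsilon> \<and>
       strong_envelope T A z c \<eta>)"
proof -
  interpret triangulated_category T by fact
  interpret F: abelian_category "full_sub T A"
    using assms(2) by (simp add: abelian_subcategory_def)
  have sub: "A \<subseteq> Obj T"
    using assms(2) by (simp add: abelian_subcategory_def additive_subcategory_def)
  have fF: "f \<in> Hom (full_sub T A) a b" and gF: "g \<in> Hom (full_sub T A) b c"
    using assms(4-8) by (simp_all add: Hom_full_sub)
  \<comment> \<open>The vanishing condition is specialised to the source \<open>a\<close> for the
    envelope and to the desuspension of \<open>c\<close> as target for the cover.\<close>
  note env = strong_envelope_iff_cokernel[OF sub F.preadditive_category_axioms assms(4-6)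
      assms(3)[OF assms(4)]]
  note cov = strong_cover_iff_kernel[OF sub F.preadditive_category_axioms assms(4-6)
      assms(3)[OF _ assms(6)]]
  show ?thesis
    unfolding F.short_exact_iff[OF fF gF]
  proof
    assume *: "is_kernel (full_sub T A) f g \<and> is_cokernel (full_sub T A) g f"
    have "g \<cdot>\<^bsub>T\<^esub> f = hzero T a c"
      using * HomD[OF assms(7)] HomD[OF assms(8)] by (simp add: is_kernel_def)
    moreover obtain z g' h where t: "dist_triangle T a b z f g' h"
      using tri_ex[OF _ _ assms(7)] Hom_Obj[OF assms(7)] by blast
    moreover obtain x u f' where t': "dist_triangle_desusp T x b c u f' g"
      using ex_dist_triangle_desusp[OF assms(8)] by blast
    \<comment> \<open>As \<open>g\<close> kills \<open>f\<close>, it factors through the weak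
      cokernel \<open>g'\<close>, giving \<eta>, and \<open>f\<close> factors through the weak
      kernel \<open>f'\<close>, giving \<epsilon>. Any such choices work, since \<open>env\<close>
      and \<open>cov\<close> apply to all of them.\<close>
    ultimately obtain \<eta> \<epsilon> where "\<eta> \<in> Hom T z c" "\<eta> \<cdot>\<^bsub>T\<^esub> g' = g" "\<epsilon> \<in> Hom T a x" "f' \<cdot>\<^bsub>T\<^esub> \<epsilon> = f"
      using dist_triangle_weak_cokernel[OF t assms(8)]
        dist_triangle_desusp_weak_kernel[OF t' assms(7)] by metis
    then show "\<exists>z x g' h u f' \<epsilon> \<eta>. dist_triangle T a b z f g' h \<and>
        dist_triangle_desusp T x b c u f' g \<and> \<epsilon> \<in> Hom T a x \<and> \<eta> \<in> Hom T z c \<and>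
        f' \<cdot>\<^bsub>T\<^esub> \<epsilon> = f \<and> \<eta> \<cdot>\<^bsub>T\<^esub> g' = g \<and> strong_cover T A a x \<epsilon> \<and> strong_envelope T A z c \<eta>"
      using t t' env cov * by blast
  qed (use env cov in blast)
qed

end
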